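(* Let $\ell,k\in\mathbb N$ with $\ell\le k$ and $k\ge2$, and let $(M;c)$ be a connected, modular coloured matroid for which $c$ is simple and which has no rainbow triangle. If $|c|=k$, then $M$ has a flat $F$ such that $|c(F)|\le\ell$ and $r_M(F)\ge\frac{\binom{\ell}{2}}{\binom{k}{2}}\,r(M)$.
   Context: A coloured matroid $(M;c)$ is a (finite) matroid $M$ with a function $c$ on $E(M)$; $|c|$ is the number of colours used and $c(F)$ the set of colours on $F$. $c$ is simple if $M$ has no loop and $c(e)=c(f)$ whenever $e,f$ are parallel. $M$ is modular if $r_M(F)+r_M(F')=r_M(F\cup F')+r_M(F\cap F')$ for all flats $F,F'$. A rainbow triangle is a three-element circuit on which $c$ is injective. *)

theory Defs
  imports Complex_Main
begin

record 'a matroid_data =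
  ground :: "'a set"
  indep :: "'a set set"

locale matroid =
  fixes M :: "('a, 'm) matroid_data_scheme"
  assumes ground_finite: "finite (ground M)"
    and indep_subset_ground: "I \<in> indep M \<Longrightarrow> I \<subseteq> ground M"
    and indep_empty: "{} \<in> indep M"
    and indep_hereditary: "\<lbrakk>J \<in> indep M; I \<subseteq> J\<rbrakk> \<Longrightarrow> I \<in> indep M"
    and indep_augment:
      "\<lbrakk>I \<in> indep M; J \<in> indep M; card I < card J\<rbrakk> \<Longrightarrow> \<exists>e\<in>J - I. insert e I \<in> indep M"

definition rank :: "('a, 'm) matroid_data_scheme \<Rightarrow> 'a set \<Rightarrow> nat" where
  "rank M X = Max (card ` {I. I \<subseteq> X \<and> I \<in> indep M})"

definition circuit :: "('a, 'm) matroid_data_scheme \<Rightarrow> 'a set \<Rightarrow> bool" where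
  "circuit M C \<longleftrightarrow> C \<subseteq> ground M \<and> C \<notin> indep M \<and> (\<forall>D. D \<subset> C \<longrightarrow> D \<in> indep M)"

definition is_loop :: "('a, 'm) matroid_data_scheme \<Rightarrow> 'a \<Rightarrow> bool" where
  "is_loop M e \<longleftrightarrow> circuit M {e}"

definition parallel :: "('a, 'm) matroid_data_scheme \<Rightarrow> 'a \<Rightarrow> 'a \<Rightarrow> bool" where
  "parallel M e f \<longleftrightarrow> e \<noteq> f \<and> circuit M {e, f}"

definition flat :: "('a, 'm) matroid_data_scheme \<Rightarrow> 'a set \<Rightarrow> bool" where
  "flat M F \<longleftrightarrow> F \<subseteq> ground M \<and> (\<forall>e\<in>ground M - F. rank M F < rank M (insert e F))"

definition connected_matroid :: "('a, 'm) matroid_data_scheme \<Rightarrow> bool" where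
  "connected_matroid M \<longleftrightarrow>
     (\<forall>e\<in>ground M. \<forall>f\<in>ground M. e \<noteq> f \<longrightarrow> (\<exists>C. circuit M C \<and> e \<in> C \<and> f \<in> C))"

definition modular_matroid :: "('a, 'm) matroid_data_scheme \<Rightarrow> bool" where
  "modular_matroid M \<longleftrightarrow>
     (\<forall>F F'. flat M F \<and> flat M F' \<longrightarrow>
        rank M F + rank M F' = rank M (F \<union> F') + rank M (F \<inter> F'))"

text \<open>A colouring is a total function of which only the values on the ground set matter.\<close>

definition simple_colouring :: "('a, 'm) matroid_data_scheme \<Rightarrow> ('a \<Rightarrow> 'c) \<Rightarrow> bool" where
  "simple_colouring M c \<longleftrightarrow>
     (\<forall>e\<in>ground M. \<not> is_loop M e) \<and>
     (\<forall>e\<in>ground M. \<forall>f\<in>ground M. parallel M e f \<longrightarrow> c e = c f)"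

definition rainbow_triangle ::
    "('a, 'm) matroid_data_scheme \<Rightarrow> ('a \<Rightarrow> 'c) \<Rightarrow> 'a set \<Rightarrow> bool" where
  "rainbow_triangle M c T \<longleftrightarrow> circuit M T \<and> card T = 3 \<and> inj_on c T"

definition num_colours :: "('a, 'm) matroid_data_scheme \<Rightarrow> ('a \<Rightarrow> 'c) \<Rightarrow> nat" where
  "num_colours M c = card (c ` ground M)"

end

theory Submission
  imports Defs
begin

text \<open>
  Call a flat \<open>F\<close> of a flat \<open>G\<close> homogeneous if the colour of a point \<open>e\<close> of \<open>G\<close> outside \<open>F\<close> depends
  only on the span of \<open>F\<close> and \<open>e\<close>. Every nonempty flat \<open>G\<close> has a proper flat \<open>F\<close> such that \<open>G - F\<close> carries
  at most two colours, by induction on the rank. In rank 3 this is a double count in a projective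
  plane whose lines each miss a colour; finiteness is essential there, since \<open>p\<close>-adic valuations
  colour infinite planes without rainbow lines. In higher rank one extends a maximal
  homogeneous flat of a hyperplane.

  Iterating, the rank of \<open>M\<close> is split into layers, each with at most two colours. For a set \<open>S\<close> of
  colours, complements of the layers coloured from \<open>S\<close> span a flat coloured from \<open>S\<close> whose rank is
  the sum of the ranks of these layers. Averaging over all \<open>S\<close> of size \<open>l\<close> gives the bound, as a given
  pair of colours lies in \<open>S\<close> with probability \<open>(l choose 2) / (k choose 2)\<close>.
\<close>

section \<open>Closure and rank\<close>

context matroid
begin

text \<open>The closure operator. Membership in the ground set has to be demanded: elements outside
  it never raise a rank, so they would lie in every closure.\<close>

definition cl :: "'a set \<Rightarrow> 'a set" where
  "cl X = {e \<in> ground M. rank M (insert e X) = rank M X}"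

lemma in_cl_iff: "e \<in> cl X \<longleftrightarrow> e \<in> ground M \<and> rank M (insert e X) = rank M X"
  by (simp add: cl_def)

lemma finite_indep_subsets: "finite {I. I \<subseteq> X \<and> I \<in> indep M}"
  by (rule finite_subset[of _ "Pow (ground M)"]) (use indep_subset_ground ground_finite in auto)

lemma card_indep_le_rank: "I \<subseteq> X \<Longrightarrow> I \<in> indep M \<Longrightarrow> card I \<le> rank M X"
  unfolding rank_def by (rule Max_ge) (use finite_indep_subsets in auto)

lemma finite_indep: "I \<in> indep M \<Longrightarrow> finite I"
  using indep_subset_ground ground_finite finite_subset by blast

lemma rank_attained: obtains I where "I \<subseteq> X" "I \<in> indep M" "card I = rank M X"
proof -
  have "rank M X \<in> card ` {I. I \<subseteq> X \<and> I \<in> indep M}"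
    unfolding rank_def by (rule Max_in) (use finite_indep_subsets indep_empty in auto)
  then show ?thesis using that by auto
qed

lemma rank_mono: "X \<subseteq> Y \<Longrightarrow> rank M X \<le> rank M Y"
  by (metis rank_attained card_indep_le_rank order_trans)

lemma rank_le_card: "finite X \<Longrightarrow> rank M X \<le> card X"
  by (metis rank_attained card_mono)

lemma rank_empty [simp]: "rank M {} = 0"
  using rank_le_card[of "{}"] by simp

lemma rank_indep: "I \<in> indep M \<Longrightarrow> rank M I = card I"
  by (metis card_indep_le_rank rank_le_card finite_indep le_antisym order_refl)

lemma indep_iff_rank: "finite X \<Longrightarrow> X \<in> indep M \<longleftrightarrow> rank M X = card X"
  by (metis rank_indep rank_attained card_subset_eq)

lemma extend_to_basis:
  assumes "I \<in> indep M" "I \<subseteq> X"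
  obtains J where "I \<subseteq> J" "J \<subseteq> X" "J \<in> indep M" "card J = rank M X"
proof -
  have "\<exists>J. I \<subseteq> J \<and> J \<subseteq> X \<and> J \<in> indep M \<and> card J = rank M X"
    using assms
  proof (induction "rank M X - card I" arbitrary: I rule: less_induct)
    case less
    show ?case
    proof (cases "card I = rank M X")
      case True
      then show ?thesis using less.prems by blast
    next
      case False
      then have lt: "card I < rank M X" using card_indep_le_rank[OF less.prems(2,1)] by simp
      obtain B where B: "B \<subseteq> X" "B \<in> indep M" "card B = rank M X" by (rule rank_attained)
      obtain e where e: "e \<in> B - I" "insert e I \<in> indep M"
        using indep_augment[of I B] less.prems lt B by auto
      have "card (insert e I) = Suc (card I)"
        using e finite_indep[OF less.prems(1)] by simp
      then have 1: "rank M X - card (insert e I) < rank M X - card I" using lt by simp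
      have 2: "insert e I \<subseteq> X" using e B less.prems by auto
      obtain J where "insert e I \<subseteq> J \<and> J \<subseteq> X \<and> J \<in> indep M \<and> card J = rank M X"
        using less.hyps[OF 1 e(2) 2] by (elim exE)
      then show ?thesis by auto
    qed
  qed
  then show ?thesis using that by blast
qed

text \<open>Extend a basis \<open>I\<close> of X \<inter> Y to a basis \<open>J\<close> of X
  \<union> Y. The traces of \<open>J\<close> on \<open>X\<close> and \<open>Y\<close> are
  independent, and inclusion-exclusion counts their sizes.\<close>

lemma rank_submodular: "rank M (X \<union> Y) + rank M (X \<inter> Y) \<le> rank M X + rank M Y"
proof -
  obtain I where I: "I \<subseteq> X \<inter> Y" "I \<in> indep M" "card I = rank M (X \<inter> Y)" by (rule rank_attained)
  obtain J where J: "I \<subseteq> J" "J \<subseteq> X \<union> Y" "J \<in> indep M" "card J = rank M (X \<union> Y)"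
    by (rule extend_to_basis[of I "X \<union> Y"]) (use I in auto)
  have fin: "finite J" using J finite_indep by auto
  have "card J + card I \<le> card (J \<inter> X \<union> J \<inter> Y) + card (J \<inter> X \<inter> (J \<inter> Y))"
    by (intro add_mono card_mono) (use J I fin in auto)
  also have "\<dots> = card (J \<inter> X) + card (J \<inter> Y)"
    by (rule card_Un_Int[symmetric]) (use fin in auto)
  also have "\<dots> \<le> rank M X + rank M Y"
    by (intro add_mono card_indep_le_rank indep_hereditary[OF J(3)]) auto
  finally show ?thesis using I J by simp
qed

lemma rank_Un_le: "rank M (X \<union> Y) \<le> rank M X + rank M Y"
  using rank_submodular[of X Y] by simp

lemma rank_insert_le: "rank M (insert e X) \<le> rank M X + 1"
  using rank_Un_le[of "{e}" X] rank_le_card[of "{e}"] by simp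

lemma rank_le_insert: "rank M X \<le> rank M (insert e X)"
  by (rule rank_mono) auto

text \<open>By submodularity, adding \<open>e\<close> raises the rank of the larger set by no more
  than that of the smaller one.\<close>

lemma cl_mono:
  assumes "X \<subseteq> Y"
  shows "cl X \<subseteq> cl Y"
proof
  fix e assume e: "e \<in> cl X"
  have "rank M (insert e X \<union> Y) + rank M (insert e X \<inter> Y) \<le> rank M (insert e X) + rank M Y"
    by (rule rank_submodular)
  moreover have "insert e X \<union> Y = insert e Y" using assms by auto
  moreover have "rank M X \<le> rank M (insert e X \<inter> Y)" by (rule rank_mono) (use assms in auto)
  moreover have "rank M (insert e X) = rank M X" using e by (simp add: in_cl_iff)
  moreover have "rank M Y \<le> rank M (insert e Y)" by (rule rank_mono) auto
  ultimately have "rank M (insert e Y) = rank M Y" by simp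
  then show "e \<in> cl Y" using e by (simp add: in_cl_iff)
qed

lemma cl_ground: "cl X \<subseteq> ground M"
  by (auto simp: in_cl_iff)

lemma subset_cl: "X \<subseteq> ground M \<Longrightarrow> X \<subseteq> cl X"
  by (auto simp: in_cl_iff insert_absorb)

lemma rank_Un_subset_cl:
  assumes "Y \<subseteq> cl X"
  shows "rank M (X \<union> Y) = rank M X"
proof -
  have "finite Y" using assms cl_ground ground_finite finite_subset by metis
  then show ?thesis using assms
  proof (induction Y rule: finite_induct)
    case (insert y Y)
    have "y \<in> cl (X \<union> Y)" using cl_mono[of X "X \<union> Y"] insert.prems by auto
    then show ?case using insert by (simp add: in_cl_iff)
  qed simp
qed

lemma rank_cl: "X \<subseteq> ground M \<Longrightarrow> rank M (cl X) = rank M X"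
  using rank_Un_subset_cl[of "cl X" X] subset_cl[of X] by (simp add: sup.absorb2)

lemma flat_iff_cl: "flat M F \<longleftrightarrow> F \<subseteq> ground M \<and> cl F \<subseteq> F"
proof -
  have "rank M F < rank M (insert e F) \<longleftrightarrow> rank M (insert e F) \<noteq> rank M F" for e
    using rank_le_insert[of F e] by auto
  then show ?thesis unfolding flat_def subset_iff in_cl_iff by auto
qed

lemma flat_ground: "flat M F \<Longrightarrow> F \<subseteq> ground M"
  by (simp add: flat_def)

lemma flat_cl_eq: "flat M F \<Longrightarrow> cl F = F"
  using flat_iff_cl[of F] subset_cl[of F] by auto

lemma cl_least: "flat M F \<Longrightarrow> X \<subseteq> F \<Longrightarrow> cl X \<subseteq> F"
  using cl_mono[of X F] flat_cl_eq[of F] by simp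

lemma flat_cl [intro]: "X \<subseteq> ground M \<Longrightarrow> flat M (cl X)"
proof -
  assume X: "X \<subseteq> ground M"
  have "cl (cl X) \<subseteq> cl X"
  proof
    fix e assume e: "e \<in> cl (cl X)"
    then have "rank M (insert e (cl X)) = rank M X" by (simp add: in_cl_iff rank_cl[OF X])
    moreover have "rank M (insert e X) \<le> rank M (insert e (cl X))"
      by (rule rank_mono) (use subset_cl[OF X] in auto)
    moreover have "rank M X \<le> rank M (insert e X)" by (rule rank_mono) auto
    ultimately show "e \<in> cl X" using e by (simp add: in_cl_iff)
  qed
  then show ?thesis by (simp add: flat_iff_cl cl_ground)
qed

lemma flat_Int: "flat M F \<Longrightarrow> flat M G \<Longrightarrow> flat M (F \<inter> G)"
  using cl_mono[of "F \<inter> G" F] cl_mono[of "F \<inter> G" G] by (auto simp: flat_iff_cl)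

lemma flat_ground_set: "flat M (ground M)"
  by (simp add: flat_def)

lemma rank_insert_flat:
  assumes "flat M F" "e \<in> ground M" "e \<notin> F"
  shows "rank M (insert e F) = rank M F + 1"
proof -
  have "rank M F < rank M (insert e F)" using assms by (simp add: flat_def)
  then show ?thesis using rank_insert_le[of e F] by simp
qed

lemma flat_subset_rank_eq:
  assumes "flat M F" "flat M G" "F \<subseteq> G" "rank M G \<le> rank M F"
  shows "F = G"
proof (rule ccontr)
  assume "F \<noteq> G"
  then obtain e where "e \<in> G" "e \<notin> F" using assms by auto
  then have "rank M F < rank M (insert e F)" "rank M (insert e F) \<le> rank M G"
    using assms by (auto simp: flat_def intro: rank_mono)
  then show False using assms by simp
qed

lemma flat_psubset_rank: "flat M F \<Longrightarrow> flat M G \<Longrightarrow> F \<subset> G \<Longrightarrow> rank M F < rank M G"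
  using flat_subset_rank_eq[of F G] by (metis not_le psubsetE)

text \<open>Steinitz exchange: \<open>f\<close> raises the rank of \<open>X\<close> by one, which is
  all that \<open>e\<close> can contribute, so \<open>e\<close> adds nothing once \<open>f\<close>
  is present.\<close>

lemma cl_exchange:
  assumes "X \<subseteq> ground M" "e \<in> ground M" "f \<in> cl (insert e X)" "f \<notin> cl X"
  shows "e \<in> cl (insert f X)"
proof -
  have f: "f \<in> ground M" using assms cl_ground by auto
  have "rank M (insert f X) \<noteq> rank M X" using assms f by (auto simp: in_cl_iff)
  then have "rank M (insert f X) = rank M X + 1"
    using rank_insert_le[of f X] rank_le_insert[of X f] by simp
  moreover have "rank M (insert e (insert f X)) = rank M (insert e X)"
    using assms by (simp add: in_cl_iff insert_commute)
  ultimately have "rank M (insert e (insert f X)) \<le> rank M (insert f X)"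
    using rank_insert_le[of e X] by simp
  then show ?thesis using assms rank_le_insert[of "insert f X" e]
    by (simp add: in_cl_iff)
qed

text \<open>Closing up after adding one outside point raises the rank by exactly one, so a chain of
  flats from \<open>F\<close> to \<open>G\<close> skips no rank.\<close>

lemma extend_flat:
  assumes "flat M F" "flat M G" "F \<subseteq> G" "rank M F \<le> n" "n \<le> rank M G"
  obtains H where "flat M H" "F \<subseteq> H" "H \<subseteq> G" "rank M H = n"
proof -
  have "\<exists>H. flat M H \<and> F \<subseteq> H \<and> H \<subseteq> G \<and> rank M H = n"
    using assms
  proof (induction "n - rank M F" arbitrary: F)
    case 0
    then show ?case by auto
  next
    case (Suc m)
    then have "F \<noteq> G" by auto
    then obtain e where e: "e \<in> G" "e \<notin> F" using Suc by auto
    let ?F = "cl (insert e F)"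
    have sub: "insert e F \<subseteq> ground M" using e flat_ground Suc.prems by blast
    have r: "rank M ?F = rank M F + 1"
      using rank_cl[OF sub] rank_insert_flat[of F e] e sub Suc.prems by simp
    have "?F \<subseteq> G" by (rule cl_least) (use e Suc in auto)
    moreover have F: "F \<subseteq> ?F" using subset_cl[OF sub] by auto
    moreover have "m = n - rank M ?F" "rank M ?F \<le> n" using Suc.hyps(2) r by auto
    ultimately have "\<exists>H. flat M H \<and> ?F \<subseteq> H \<and> H \<subseteq> G \<and> rank M H = n"
      using Suc.prems sub by - (rule Suc.hyps(1), auto)
    then obtain H where H: "flat M H" "?F \<subseteq> H" "H \<subseteq> G" "rank M H = n" by auto
    have "F \<subseteq> H" using F H(2) by (rule subset_trans)
    with H show ?case by auto
  qed
  then show ?thesis using that by blast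
qed

end

section \<open>Three-coloured finite planes\<close>

locale finite_plane =
  fixes P :: "'p set" and Ls :: "'p set set"
  assumes finite_points: "finite P"
    and line_subset: "L \<in> Ls \<Longrightarrow> L \<subseteq> P"
    and line_exists: "x \<in> P \<Longrightarrow> y \<in> P \<Longrightarrow> x \<noteq> y \<Longrightarrow> \<exists>L\<in>Ls. x \<in> L \<and> y \<in> L"
    and line_unique: "\<lbrakk>L \<in> Ls; L' \<in> Ls; x \<in> L; y \<in> L; x \<in> L'; y \<in> L'; x \<noteq> y\<rbrakk> \<Longrightarrow> L = L'"
    and lines_meet: "L \<in> Ls \<Longrightarrow> L' \<in> Ls \<Longrightarrow> L \<inter> L' \<noteq> {}"
begin

definition tricoloured :: "'p set \<Rightarrow> 'p set \<Rightarrow> 'p set \<Rightarrow> bool" where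
  "tricoloured A B C \<longleftrightarrow> A \<union> B \<union> C = P \<and> A \<inter> B = {} \<and> A \<inter> C = {} \<and> B \<inter> C = {} \<and>
     (\<forall>L\<in>Ls. L \<inter> A = {} \<or> L \<inter> B = {} \<or> L \<inter> C = {})"

lemma tricoloured_swap: "tricoloured A B C \<Longrightarrow> tricoloured B A C"
  and tricoloured_rotate: "tricoloured A B C \<Longrightarrow> tricoloured B C A"
  unfolding tricoloured_def by blast+

lemma finite_lines: "finite Ls"
  by (rule finite_subset[of _ "Pow P"]) (use line_subset finite_points in auto)

lemma finite_line: "L \<in> Ls \<Longrightarrow> finite L"
  using line_subset finite_points finite_subset by blast

text \<open>Projecting from \<open>e\<close> matches the points of class \<open>B\<close> on \<open>L0\<close> with the lines through
  \<open>e\<close> that meet \<open>B\<close>.\<close>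

lemma card_pencil:
  assumes tri: "tricoloured A B C" and e: "e \<in> A"
    and L0: "L0 \<in> Ls" "L0 \<inter> B \<noteq> {}" "L0 \<inter> C \<noteq> {}"
  shows "card {L \<in> Ls. e \<in> L \<and> L \<inter> B \<noteq> {}} = card (L0 \<inter> B)"
proof -
  have L0A: "L0 \<inter> A = {}" using tri L0 by (auto simp: tricoloured_def)
  define g where "g y = (SOME L. L \<in> Ls \<and> e \<in> L \<and> y \<in> L)" for y
  have eP: "e \<in> P" using tri e by (auto simp: tricoloured_def)
  have g: "g y \<in> Ls \<and> e \<in> g y \<and> y \<in> g y" if "y \<in> L0" for y
  proof -
    have "y \<in> P" "y \<noteq> e" using that L0A e line_subset L0 by auto
    then have "\<exists>L. L \<in> Ls \<and> e \<in> L \<and> y \<in> L" using line_exists eP by blast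
    then show ?thesis unfolding g_def by (rule someI_ex)
  qed
  have "bij_betw g (L0 \<inter> B) {L \<in> Ls. e \<in> L \<and> L \<inter> B \<noteq> {}}"
  proof (rule bij_betw_imageI)
    show "inj_on g (L0 \<inter> B)"
    proof (rule inj_onI, rule ccontr)
      fix y y' assume y: "y \<in> L0 \<inter> B" "y' \<in> L0 \<inter> B" "g y = g y'" "y \<noteq> y'"
      \<comment> \<open>Two points of \<open>L0\<close> on a common line through \<open>e\<close>
        would make that line equal to \<open>L0\<close>, which misses \<open>A\<close> and hence
        \<open>e\<close>.\<close>
      then have "g y = L0" using line_unique[of "g y" L0 y y'] g[of y] g[of y'] L0 by auto
      then show False using g[of y] y e L0A by auto
    qed
    show "g ` (L0 \<inter> B) = {L \<in> Ls. e \<in> L \<and> L \<inter> B \<noteq> {}}"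
    proof
      show "g ` (L0 \<inter> B) \<subseteq> {L \<in> Ls. e \<in> L \<and> L \<inter> B \<noteq> {}}" using g by auto
      show "{L \<in> Ls. e \<in> L \<and> L \<inter> B \<noteq> {}} \<subseteq> g ` (L0 \<inter> B)"
      proof
        fix L assume "L \<in> {L \<in> Ls. e \<in> L \<and> L \<inter> B \<noteq> {}}"
        then have L: "L \<in> Ls" "e \<in> L" "L \<inter> B \<noteq> {}" by auto
        obtain y where y: "y \<in> L" "y \<in> L0" using lines_meet[OF L(1) L0(1)] by auto
        \<comment> \<open>The line \<open>L\<close> meets \<open>A\<close> in \<open>e\<close> and
          also meets \<open>B\<close>, so it has no point of \<open>C\<close>.\<close>
        have "y \<notin> C" using tri L e y by (auto simp: tricoloured_def)
        moreover have "y \<notin> A" using y L0A by auto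
        moreover have "y \<in> P" using y L0 line_subset by auto
        ultimately have "y \<in> L0 \<inter> B" using tri y by (auto simp: tricoloured_def)
        moreover have "L = g y" using line_unique[of L "g y" e y] g[OF y(2)] y L e L0A by auto
        ultimately show "L \<in> g ` (L0 \<inter> B)" by auto
      qed
    qed
  qed
  then show ?thesis by (simp add: bij_betw_same_card)
qed

text \<open>The lines through \<open>x\<close> partition the points other than
  \<open>x\<close>.\<close>

lemma card_class_eq_sum:
  assumes "A \<subseteq> P" "x \<in> P"
  shows "card (A - {x}) = (\<Sum>L | L \<in> Ls \<and> x \<in> L. card (L \<inter> A - {x}))"
proof -
  have "A - {x} = (\<Union>L \<in> {L \<in> Ls. x \<in> L}. L \<inter> A - {x})"
    using line_exists assms by blast
  also have "card \<dots> = (\<Sum>L | L \<in> Ls \<and> x \<in> L. card (L \<inter> A - {x}))"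
  proof (rule card_UN_disjoint)
    show "\<forall>L\<in>{L \<in> Ls. x \<in> L}. \<forall>L'\<in>{L \<in> Ls. x \<in> L}. L \<noteq> L' \<longrightarrow>
        (L \<inter> A - {x}) \<inter> (L' \<inter> A - {x}) = {}"
      using line_unique by blast
  qed (use finite_lines finite_line in auto)
  finally show ?thesis .
qed

text \<open>The class \<open>A\<close> is counted along the lines through a point of \<open>B\<close> and along the lines
  through a point of \<open>A\<close>.\<close>

lemma card_line_classes_less:
  assumes tri: "tricoloured A B C"
    and two: "\<And>L. L \<in> Ls \<Longrightarrow> L \<inter> A \<noteq> {} \<Longrightarrow> L \<inter> C \<noteq> {} \<Longrightarrow> 2 \<le> card (L \<inter> A)"
      "\<And>L. L \<in> Ls \<Longrightarrow> L \<inter> B \<noteq> {} \<Longrightarrow> L \<inter> C \<noteq> {} \<Longrightarrow> 2 \<le> card (L \<inter> C)"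
    and L0: "L0 \<in> Ls" "L0 \<inter> B \<noteq> {}" "L0 \<inter> C \<noteq> {}"
    and L1: "L1 \<in> Ls" "L1 \<inter> A \<noteq> {}" "L1 \<inter> C \<noteq> {}"
  shows "card (L0 \<inter> B) < card (L1 \<inter> A)"
proof (rule ccontr)
  obtain a b d where a: "a \<in> A" and b: "b \<in> B" and d: "d \<in> C" using L0 L1 by auto
  have disj: "A \<inter> B = {}" "A \<inter> C = {}" "B \<inter> C = {}" and union: "A \<union> B \<union> C = P"
    using tri by (auto simp: tricoloured_def)
  have abP: "a \<in> P" "b \<in> P" "A \<subseteq> P" using union a b by auto
  have finA: "finite A" using abP(3) finite_points by (rule finite_subset)
  have L0A: "L0 \<inter> A = {}" using tri L0 by (auto simp: tricoloured_def)
  \<comment> \<open>By \<open>card_pencil\<close>, \<alpha> and \<gamma> are the numbers of points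
    of \<open>A\<close> on every line joining \<open>A\<close> to \<open>B\<close> and to
    \<open>C\<close> respectively, and \<gamma> also counts the lines from \<open>b\<close> to
    \<open>A\<close>. The numbers \<beta> and \<open>\<beta>'\<close> count the lines from
    \<open>a\<close> to \<open>B\<close> and to \<open>C\<close>.\<close>
  define \<alpha> where "\<alpha> = card {L \<in> Ls. d \<in> L \<and> L \<inter> A \<noteq> {}}"
  define \<beta> where "\<beta> = card (L0 \<inter> B)"
  define \<beta>' where "\<beta>' = card (L0 \<inter> C)"
  define \<gamma> where "\<gamma> = card {L \<in> Ls. b \<in> L \<and> L \<inter> A \<noteq> {}}"
  have AB: "card (L \<inter> A) = \<alpha>" if "L \<in> Ls" "L \<inter> A \<noteq> {}" "L \<inter> B \<noteq> {}" for L
    unfolding \<alpha>_def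
    by (rule card_pencil[symmetric, OF tricoloured_rotate[OF tricoloured_rotate[OF tri]] d that])
  have AC: "card (L \<inter> A) = \<gamma>" if "L \<in> Ls" "L \<inter> A \<noteq> {}" "L \<inter> C \<noteq> {}" for L
    unfolding \<gamma>_def by (rule card_pencil[symmetric, OF tricoloured_swap[OF tri] b that])
  define N where "N = {L \<in> Ls. b \<in> L \<and> L \<inter> A \<noteq> {}}"
  define N1 where "N1 = {L \<in> Ls. a \<in> L \<and> L \<inter> B \<noteq> {}}"
  define N2 where "N2 = {L \<in> Ls. a \<in> L \<and> L \<inter> C \<noteq> {}}"
  have N1: "card N1 = \<beta>" unfolding N1_def \<beta>_def by (rule card_pencil[OF tri a L0])
  have "tricoloured A C B" by (rule tricoloured_swap[OF tricoloured_rotate[OF tricoloured_rotate[OF tri]]])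
  from card_pencil[OF this a L0(1,3,2)] have N2: "card N2 = \<beta>'" unfolding N2_def \<beta>'_def .
  have bA: "A - {b} = A" using b disj by auto
  have "card A = (\<Sum>L | L \<in> Ls \<and> b \<in> L. card (L \<inter> A - {b}))"
    using card_class_eq_sum[OF abP(3,2)] bA by simp
  also have "\<dots> = (\<Sum>L | L \<in> Ls \<and> b \<in> L. card (L \<inter> A))"
    using b disj by (intro sum.cong refl arg_cong[where f = card]) auto
  also have "\<dots> = (\<Sum>L\<in>N. card (L \<inter> A))"
    by (rule sum.mono_neutral_right) (auto simp: N_def finite_lines)
  also have "\<dots> = (\<Sum>L\<in>N. \<alpha>)" using AB b by (intro sum.cong) (auto simp: N_def)
  finally have cardA: "card A = \<gamma> * \<alpha>" by (simp add: N_def \<gamma>_def)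
  \<comment> \<open>A line through \<open>a\<close> must cross \<open>L0\<close>, which avoids
    \<open>A\<close>, so it reaches \<open>B\<close> or \<open>C\<close>; it cannot reach
    both.\<close>
  have split: "{L \<in> Ls. a \<in> L} = N1 \<union> N2"
  proof -
    have "L \<inter> B \<noteq> {} \<or> L \<inter> C \<noteq> {}" if "L \<in> Ls" for L
      using lines_meet[OF that L0(1)] L0A line_subset[OF that] union by blast
    then show ?thesis by (auto simp: N1_def N2_def)
  qed
  have disjN: "N1 \<inter> N2 = {}" using tri a by (auto simp: N1_def N2_def tricoloured_def)
  have finN: "finite N1" "finite N2" by (auto simp: N1_def N2_def finite_lines)
  have pt: "card (L \<inter> A - {a}) = card (L \<inter> A) - 1" if "a \<in> L" for L
    using a that finA by simp
  have "card (A - {a}) = (\<Sum>L\<in>N1. card (L \<inter> A - {a})) + (\<Sum>L\<in>N2. card (L \<inter> A - {a}))"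
    using card_class_eq_sum[OF abP(3,1)] split sum.union_disjoint[OF finN disjN] by simp
  also have "(\<Sum>L\<in>N1. card (L \<inter> A - {a})) = (\<Sum>L\<in>N1. \<alpha> - 1)"
    using AB pt a by (intro sum.cong) (auto simp: N1_def)
  also have "(\<Sum>L\<in>N2. card (L \<inter> A - {a})) = (\<Sum>L\<in>N2. \<gamma> - 1)"
    using AC pt a by (intro sum.cong) (auto simp: N2_def)
  finally have "card (A - {a}) = \<beta> * (\<alpha> - 1) + \<beta>' * (\<gamma> - 1)" using N1 N2 by simp
  moreover have "card A = card (A - {a}) + 1"
    using a finA by (metis Suc_eq_plus1 card.remove)
  \<comment> \<open>The left side counts \<open>A\<close> from \<open>b\<close>; the right side
    counts it from \<open>a\<close>, the summand 1 being \<open>a\<close> itself.\<close>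
  ultimately have eq: "\<gamma> * \<alpha> = 1 + \<beta> * (\<alpha> - 1) + \<beta>' * (\<gamma> - 1)" using cardA by simp
  have \<gamma>1: "card (L1 \<inter> A) = \<gamma>" by (rule AC[OF L1])
  have g2: "2 \<le> \<gamma>" using two(1)[OF L1] \<gamma>1 by simp
  have b2: "2 \<le> \<beta>'" unfolding \<beta>'_def by (rule two(2)[OF L0])
  assume "\<not> card (L0 \<inter> B) < card (L1 \<inter> A)"
  \<comment> \<open>With \<gamma> \<le> \<beta> the right side of \<open>eq\<close> is at least
    \<open>1 + \<gamma> * (\<alpha> - 1) + 2 * (\<gamma> - 1)\<close>, which forces \<gamma> \<le>
    1, against \<open>g2\<close>.\<close>
  then have "\<gamma> \<le> \<beta>" using \<gamma>1 \<beta>_def by simp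
  then have "\<gamma> * (\<alpha> - 1) \<le> \<beta> * (\<alpha> - 1)" by simp
  moreover have "2 * (\<gamma> - 1) \<le> \<beta>' * (\<gamma> - 1)" using b2 by simp
  moreover have "\<gamma> * \<alpha> \<le> \<gamma> * (\<alpha> - 1) + \<gamma>" by (cases \<alpha>) auto
  ultimately show False using eq g2 by linarith
qed

text \<open>The hypotheses are symmetric in \<open>A\<close> and \<open>B\<close>, so the strict
  inequality of \<open>card_line_classes_less\<close> can be applied in both directions.\<close>

lemma no_tricoloured_plane:
  assumes tri: "tricoloured A B C" and ne: "A \<noteq> {}" "B \<noteq> {}" "C \<noteq> {}"
    and two: "\<And>L X Y. \<lbrakk>L \<in> Ls; X \<in> {A, B, C}; Y \<in> {A, B, C}; X \<noteq> Y; L \<inter> X \<noteq> {}; L \<inter> Y \<noteq> {}\<rbrakk>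
        \<Longrightarrow> 2 \<le> card (L \<inter> X)"
  shows False
proof -
  obtain a b d where pts: "a \<in> A" "b \<in> B" "d \<in> C" using ne by auto
  have disj: "A \<inter> B = {}" "A \<inter> C = {}" "B \<inter> C = {}" and P: "a \<in> P" "b \<in> P" "d \<in> P"
    using tri pts by (auto simp: tricoloured_def)
  have neq: "A \<noteq> C" "C \<noteq> B" "B \<noteq> C" "C \<noteq> A" using disj ne by auto
  obtain L0 where L0: "L0 \<in> Ls" "b \<in> L0" "d \<in> L0" using line_exists[of b d] P pts disj by auto
  obtain L1 where L1: "L1 \<in> Ls" "a \<in> L1" "d \<in> L1" using line_exists[of a d] P pts disj by auto
  have ne': "L0 \<inter> B \<noteq> {}" "L0 \<inter> C \<noteq> {}" "L1 \<inter> A \<noteq> {}" "L1 \<inter> C \<noteq> {}"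
    using L0 L1 pts by auto
  have two_A: "2 \<le> card (L \<inter> A)" and two_C: "2 \<le> card (L \<inter> C)"
    if "L \<in> Ls" "L \<inter> A \<noteq> {}" "L \<inter> C \<noteq> {}" for L
    using two[of L A C] two[of L C A] that neq by simp_all
  have two_B: "2 \<le> card (L \<inter> B)" and two_C': "2 \<le> card (L \<inter> C)"
    if "L \<in> Ls" "L \<inter> B \<noteq> {}" "L \<inter> C \<noteq> {}" for L
    using two[of L B C] two[of L C B] that neq by simp_all
  have "card (L0 \<inter> B) < card (L1 \<inter> A)"
    by (rule card_line_classes_less[OF tri two_A two_C' L0(1) ne'(1,2) L1(1) ne'(3,4)])
  moreover have "card (L1 \<inter> A) < card (L0 \<inter> B)"
    by (rule card_line_classes_less[OF tricoloured_swap[OF tri] two_B two_C L1(1) ne'(3,4) L0(1) ne'(1,2)])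
  ultimately show False by simp
qed

end

section \<open>Coloured modular matroids\<close>

locale rainbow_free_geometry = matroid M for M :: "'a matroid_data" +
  fixes c :: "'a \<Rightarrow> 'c"
  assumes modular: "modular_matroid M"
    and simple: "simple_colouring M c"
    and rainbow_free: "\<not> (\<exists>T. rainbow_triangle M c T)"
begin

section \<open>Points, parallel classes and their colours\<close>

lemma rank_singleton: "e \<in> ground M \<Longrightarrow> rank M {e} = 1"
proof -
  assume e: "e \<in> ground M"
  have "\<not> circuit M {e}" using simple e by (auto simp: simple_colouring_def is_loop_def)
  then have "{e} \<in> indep M" using e indep_empty by (auto simp: circuit_def psubset_eq subset_singleton_iff)
  then show ?thesis using rank_indep by fastforce
qed

lemma rank_pos:
  assumes "X \<subseteq> ground M" "X \<noteq> {}"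
  shows "0 < rank M X"
proof -
  obtain e where "e \<in> X" using assms by auto
  then show ?thesis using rank_singleton[of e] rank_mono[of "{e}" X] assms by auto
qed

lemma cl_empty [simp]: "cl {} = {}"
  using rank_singleton by (auto simp: in_cl_iff)

lemma flat_empty: "flat M {}"
  by (simp add: flat_iff_cl)

lemma rank_pair_le: "rank M {e, f} \<le> 2"
  using rank_le_card[of "{e, f}"] by (simp add: card_insert_if split: if_splits)

lemma rank_pair:
  assumes "e \<in> ground M" "f \<in> ground M" "f \<notin> cl {e}"
  shows "rank M {e, f} = 2"
proof -
  have "rank M {f, e} \<noteq> rank M {e}" using assms by (simp add: in_cl_iff)
  moreover have "rank M {e} \<le> rank M {f, e}" by (rule rank_mono) auto
  ultimately show ?thesis
    using rank_singleton[of e] rank_pair_le[of e f] assms by (simp add: insert_commute)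
qed

lemma in_cl_singleton_sym: "e \<in> ground M \<Longrightarrow> f \<in> cl {e} \<Longrightarrow> e \<in> cl {f}"
  using cl_exchange[of "{}" e f] by simp

text \<open>As there are no loops, every other element of the closure of \<open>e\<close> is
  parallel to \<open>e\<close>.\<close>

lemma cl_singleton_colour:
  assumes "e \<in> ground M" "f \<in> cl {e}"
  shows "c f = c e"
proof (cases "e = f")
  case False
  have f: "f \<in> ground M" using assms cl_ground by auto
  have "rank M {e, f} = 1" using assms rank_singleton by (auto simp: in_cl_iff insert_commute)
  then have "{e, f} \<notin> indep M" using rank_indep[of "{e, f}"] False by auto
  moreover have "{e} \<in> indep M" "{f} \<in> indep M" using indep_iff_rank rank_singleton assms f by auto
  moreover have "D \<subseteq> {e} \<or> D \<subseteq> {f}" if "D \<subset> {e, f}" for D using that by auto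
  ultimately have "circuit M {e, f}" using assms f indep_hereditary
    unfolding circuit_def by (metis bot.extremum insert_subset)
  then show ?thesis using simple False assms f by (auto simp: simple_colouring_def parallel_def)
qed simp

text \<open>Parallel elements share a colour, so three collinear elements of distinct colours are
  pairwise independent and would form a rainbow triangle.\<close>

lemma no_rainbow_line:
  assumes "e \<in> ground M" "f \<in> ground M" "g \<in> cl {e, f}"
  shows "c e = c f \<or> c g = c e \<or> c g = c f"
proof (rule ccontr)
  assume neg: "\<not> ?thesis"
  have g: "g \<in> ground M" using assms cl_ground by auto
  have dist: "e \<noteq> f" "e \<noteq> g" "f \<noteq> g" using neg by auto
  have pair: "{x, y} \<in> indep M" if "x \<in> ground M" "y \<in> ground M" "c x \<noteq> c y" for x y
  proof -
    have "y \<notin> cl {x}" using that cl_singleton_colour by metis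
    moreover have "x \<noteq> y" using that by auto
    ultimately show ?thesis using that rank_pair[of x y] indep_iff_rank[of "{x, y}"] by simp
  qed
  let ?T = "{e, f, g}"
  have "rank M ?T = rank M {e, f}" using assms by (simp add: in_cl_iff insert_commute)
  then have "rank M ?T \<le> 2" using rank_pair_le by simp
  moreover have "card ?T = 3" using dist by simp
  ultimately have "?T \<notin> indep M" using rank_indep by force
  moreover have "D \<in> indep M" if "D \<subset> ?T" for D
  proof -
    from that have "D \<subseteq> {e, f} \<or> D \<subseteq> {e, g} \<or> D \<subseteq> {f, g}" by auto
    then show ?thesis using pair indep_hereditary neg assms g by metis
  qed
  ultimately have "circuit M ?T" using assms g by (simp add: circuit_def)
  moreover have "inj_on c ?T" using neg by (auto simp: inj_on_def)
  ultimately show False using rainbow_free \<open>card ?T = 3\<close> by (auto simp: rainbow_triangle_def)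
qed

section \<open>Projective incidence geometry from modularity\<close>

lemma rank_modular:
  assumes "flat M F" "flat M G"
  shows "rank M F + rank M G = rank M (cl (F \<union> G)) + rank M (F \<inter> G)"
  using modular assms rank_cl[of "F \<union> G"] flat_ground by (auto simp: modular_matroid_def)

text \<open>The dimension formula leaves the intersection a positive rank.\<close>

lemma flats_meet:
  assumes "flat M F" "flat M G" "F \<subseteq> T" "G \<subseteq> T" "flat M T" "rank M T < rank M F + rank M G"
  obtains p where "p \<in> F" "p \<in> G"
proof -
  have "rank M (cl (F \<union> G)) \<le> rank M T"
    by (intro rank_mono cl_least) (use assms in auto)
  then have "rank M (F \<inter> G) > 0" using rank_modular[of F G] assms by linarith
  then have "F \<inter> G \<noteq> {}" by auto
  then show ?thesis using that by auto
qed

lemma in_line_exchange: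
  assumes "w \<in> ground M" "e \<in> ground M" "p \<in> cl {w, e}" "p \<notin> cl {e}"
  shows "w \<in> cl {p, e}"
  using cl_exchange[of "{e}" w p] assms by simp

text \<open>If \<open>e\<close> is outside \<open>F\<close>, then \<open>F\<close> is a hyperplane
  of the span of \<open>F\<close> and \<open>e\<close>, so it meets the line through
  \<open>w\<close> and \<open>e\<close>. If \<open>e\<close> is in \<open>F\<close>, then so is
  \<open>w\<close>, and \<open>p = w\<close> serves.\<close>

lemma line_through_apex:
  assumes F: "flat M F" and e: "e \<in> ground M" and w: "w \<in> cl (insert e F)" "w \<notin> cl {e}"
  obtains p where "p \<in> F" "w \<in> cl {p, e}" "p \<in> cl {w, e}"
proof (cases "e \<in> F")
  case True
  then have "w \<in> F" using w F by (simp add: insert_absorb flat_cl_eq)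
  moreover have "w \<in> cl {w, e}" using w cl_ground subset_cl[of "{w, e}"] e by blast
  ultimately show ?thesis using that by blast
next
  case False
  have wg: "w \<in> ground M" using w cl_ground by auto
  have sub: "insert e F \<subseteq> ground M" using e F flat_ground by auto
  have T: "flat M (cl (insert e F))" using sub by auto
  have L: "flat M (cl {w, e})" using wg e by auto
  have "{w, e} \<subseteq> cl (insert e F)" using w subset_cl[OF sub] by auto
  then have LT: "cl {w, e} \<subseteq> cl (insert e F)" using T cl_least by auto
  have "rank M (cl {w, e}) = 2" using rank_pair[of e w] w wg e rank_cl[of "{w, e}"] by (simp add: insert_commute)
  moreover have "rank M (cl (insert e F)) \<le> rank M F + 1" using rank_cl[OF sub] rank_insert_le by simp
  ultimately obtain p where p: "p \<in> F" "p \<in> cl {w, e}"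
    using flats_meet[OF F L _ LT T] subset_cl[OF sub] by auto
  have "p \<notin> cl {e}"
  proof
    assume "p \<in> cl {e}"
    then have "e \<in> cl {p}" using in_cl_singleton_sym e by auto
    then show False using cl_least[OF F, of "{p}"] p False by auto
  qed
  then show ?thesis using that p in_line_exchange[OF wg e] by blast
qed

text \<open>The Veblen-Young axiom: both lines lie in the span of \<open>h\<close>, \<open>p\<close>
  and \<open>z\<close>, whose rank is at most 3, and two lines in a plane meet.\<close>

lemma pasch:
  assumes "h \<in> ground M" "z \<in> ground M" "p \<in> ground M"
    and "w \<in> cl {h, z}" "z' \<in> cl {p, z}" "w \<notin> cl {z'}" "h \<notin> cl {p}"
  obtains q where "q \<in> cl {w, z'}" "q \<in> cl {h, p}"
proof -
  have wz: "w \<in> ground M" "z' \<in> ground M" using assms cl_ground by auto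
  let ?T = "cl {h, p, z}"
  have sub: "{h, p, z} \<subseteq> ground M" using assms by auto
  have T: "flat M ?T" using sub by auto
  have "rank M ?T \<le> 3" using rank_cl[OF sub] rank_insert_le[of h "{p, z}"] rank_pair_le[of p z] by simp
  moreover have "rank M (cl {w, z'}) = 2" using rank_pair[of z' w] assms wz rank_cl[of "{w, z'}"] by (simp add: insert_commute)
  moreover have "rank M (cl {h, p}) = 2" using rank_pair[of p h] assms rank_cl[of "{h, p}"] by (simp add: insert_commute)
  ultimately have lt: "rank M ?T < rank M (cl {w, z'}) + rank M (cl {h, p})" by simp
  have hp: "cl {h, p} \<subseteq> ?T" by (rule cl_mono) auto
  have "w \<in> ?T" using assms cl_mono[of "{h, z}" "{h, p, z}"] by auto
  moreover have "z' \<in> ?T" using assms cl_mono[of "{p, z}" "{h, p, z}"] by auto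
  ultimately have "cl {w, z'} \<subseteq> ?T" using T by (intro cl_least) auto
  moreover have "flat M (cl {w, z'})" "flat M (cl {h, p})" using wz assms by auto
  ultimately show ?thesis using flats_meet[OF _ _ _ hp T lt] that by auto
qed

lemma in_flat_line: "flat M F \<Longrightarrow> a \<in> F \<Longrightarrow> b \<in> F \<Longrightarrow> g \<in> cl {a, b} \<Longrightarrow> g \<in> F"
  using cl_least[of F "{a, b}"] by auto

lemma in_flat_point: "flat M F \<Longrightarrow> a \<in> F \<Longrightarrow> g \<in> cl {a} \<Longrightarrow> g \<in> F"
  using cl_least[of F "{a}"] by auto

lemma line_leaves_flat:
  assumes "flat M F" "p \<in> F" "e \<in> ground M" "e \<notin> F" "g \<in> cl {e, p}" "g \<notin> cl {p}"
  shows "g \<notin> F"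
proof
  assume "g \<in> F"
  have "e \<in> cl {g, p}"
    using in_line_exchange[OF assms(3) _ assms(5,6)] assms(1,2) flat_ground by auto
  then show False using in_flat_line assms \<open>g \<in> F\<close> by blast
qed

lemma cl_insert_eq:
  assumes "flat M F" "flat M G" "F \<subseteq> G" "e \<in> G" "e \<notin> F" "rank M G \<le> rank M F + 1"
  shows "cl (insert e F) = G"
proof (rule flat_subset_rank_eq)
  have sub: "insert e F \<subseteq> ground M" using assms flat_ground by blast
  then show "flat M (cl (insert e F))" by auto
  show "cl (insert e F) \<subseteq> G" by (rule cl_least) (use assms in auto)
  show "rank M G \<le> rank M (cl (insert e F))"
    using rank_cl[OF sub] rank_insert_flat[of F e] assms sub by simp
qed (use assms in auto)

text \<open>\<open>D\<close> is spanned by the elements that extend a basis of \<open>F\<close> to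
  one of \<open>G\<close>. Modularity gives the intersection rank 0, and without loops only the
  empty set has rank 0.\<close>

lemma flat_complement:
  assumes "flat M F" "flat M G" "F \<subseteq> G"
  obtains D where "flat M D" "D \<subseteq> G" "F \<inter> D = {}" "cl (F \<union> D) = G" "rank M F + rank M D = rank M G"
proof -
  obtain I where I: "I \<subseteq> F" "I \<in> indep M" "card I = rank M F" by (rule rank_attained)
  obtain J where J: "I \<subseteq> J" "J \<subseteq> G" "J \<in> indep M" "card J = rank M G"
    by (rule extend_to_basis[of I G]) (use I assms in auto)
  have Gg: "G \<subseteq> ground M" using assms flat_ground by auto
  define D where "D = cl (J - I)"
  have JI: "J - I \<subseteq> ground M" using J Gg by auto
  have D: "flat M D" "J - I \<subseteq> D" "D \<subseteq> G"
    unfolding D_def using JI subset_cl[OF JI] cl_least[OF assms(2), of "J - I"] J by auto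
  have "rank M D \<le> card (J - I)"
    using rank_cl[OF JI] rank_le_card[of "J - I"] finite_indep[OF J(3)] by (simp add: D_def)
  also have "\<dots> = rank M G - rank M F" using J I finite_indep[OF I(2)] by (simp add: card_Diff_subset)
  finally have rD: "rank M F + rank M D \<le> rank M G" using rank_mono[OF assms(3)] by simp
  have FD: "F \<union> D \<subseteq> G" using assms D by auto
  then have FDg: "F \<union> D \<subseteq> ground M" using Gg by auto
  have "J \<subseteq> cl (F \<union> D)" using I J D subset_cl[OF FDg] by blast
  then have "rank M G \<le> rank M (cl (F \<union> D))" using J card_indep_le_rank by metis
  moreover have "rank M F + rank M D = rank M (cl (F \<union> D)) + rank M (F \<inter> D)"
    by (rule rank_modular) (use assms D in auto)
  ultimately have 1: "rank M G = rank M (cl (F \<union> D))" "rank M (F \<inter> D) = 0"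
      "rank M F + rank M D = rank M G"
    using rD by linarith+
  have "cl (F \<union> D) = G"
    by (rule flat_subset_rank_eq) (use FDg cl_least[OF assms(2) FD] assms 1 in auto)
  moreover have "F \<inter> D = {}" using 1(2) rank_pos[of "F \<inter> D"] FDg by auto
  ultimately show ?thesis using that D 1 by blast
qed

section \<open>Homogeneous flats: the colouring descends to the contraction by
  \<open>F\<close>\<close>

definition homogeneous :: "'a set \<Rightarrow> 'a set \<Rightarrow> bool" where
  "homogeneous G F \<longleftrightarrow> (\<forall>e\<in>G - F. \<forall>f\<in>G - F. f \<in> cl (insert e F) \<longrightarrow> c e = c f)"

lemma homogeneousD: "\<lbrakk>homogeneous G F; e \<in> G; e \<notin> F; f \<in> G; f \<notin> F; f \<in> cl (insert e F)\<rbrakk> \<Longrightarrow> c e = c f"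
  by (auto simp: homogeneous_def)

text \<open>Homogeneity need only be tested on lines through a spanning set. The induction on
  \<open>Y\<close> extends the test from the elements of \<open>Y\<close> to all points of their
  closure.\<close>

lemma homogeneous_cl:
  assumes G: "flat M G" and X: "X \<subseteq> G"
    and lines: "\<And>x e f. \<lbrakk>x \<in> X; e \<in> G; e \<notin> cl X; f \<in> G; f \<notin> cl X; f \<in> cl {e, x}\<rbrakk> \<Longrightarrow> c e = c f"
  shows "homogeneous G (cl X)"
proof -
  have Gg: "G \<subseteq> ground M" using G flat_ground by auto
  then have Xg: "X \<subseteq> ground M" using X by auto
  have FX: "flat M (cl X)" using Xg by auto
  have XclX: "X \<subseteq> cl X" using subset_cl[OF Xg] .
  have clXG: "cl X \<subseteq> G" using cl_least[OF G X] .
  have "finite X" using Xg ground_finite finite_subset by auto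
  have main: "c e = c f" if "finite Y" "Y \<subseteq> X" "p \<in> cl Y"
      "e \<in> G" "e \<notin> cl X" "f \<in> G" "f \<notin> cl X" "f \<in> cl {e, p}" for Y p e f
    using that
  proof (induction Y arbitrary: p e f rule: finite_induct)
    case empty
    then show ?case by simp
  next
    case (insert x Y)
    note IH = insert.IH
    have xX: "x \<in> X" and YX: "Y \<subseteq> X" using insert.prems by auto
    have Yg: "Y \<subseteq> ground M" and xg: "x \<in> ground M" using YX xX Xg by auto
    have eg: "e \<in> ground M" and fg: "f \<in> ground M" using insert.prems Gg by auto
    have clY: "cl Y \<subseteq> cl X" using cl_mono[OF YX] .
    have FY: "flat M (cl Y)" using Yg by auto
    show ?case
    proof (cases "p \<in> cl Y \<or> p \<in> cl {x}")
      case True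
      then show ?thesis
      proof
        assume "p \<in> cl Y"
        then show ?thesis using IH[OF YX, of p e f] insert.prems by auto
      next
        assume p: "p \<in> cl {x}"
        have ex: "{e, x} \<subseteq> ground M" using eg xg by auto
        have "{e, p} \<subseteq> cl {e, x}" using p cl_mono[of "{x}" "{e, x}"] subset_cl[OF ex] by auto
        then have "f \<in> cl {e, x}" using cl_least[OF flat_cl[OF ex]] insert.prems by blast
        then show ?thesis using lines xX insert.prems by blast
      qed
    next
      case False
      have "p \<in> cl (insert x (cl Y))"
        using insert.prems(2) cl_mono[of "insert x Y" "insert x (cl Y)"] subset_cl[OF Yg] by auto
      then obtain p' where p': "p' \<in> cl Y" "p \<in> cl {p', x}" "p' \<in> cl {p, x}"
        using line_through_apex[OF FY xg] False by blast
      have pg: "p \<in> ground M" "p' \<in> ground M" using p' cl_ground by auto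
      have "p \<notin> cl {p'}" using in_flat_point[OF FY p'(1)] False by auto
      then have x: "x \<in> cl {p', p}"
        using in_line_exchange[OF xg pg(2), of p] p' by (simp add: insert_commute)
      have fx: "f \<notin> cl {x}" using in_flat_point[OF FX] XclX xX insert.prems by blast
      have ep': "e \<notin> cl {p'}" using in_flat_point[OF FX, of p'] clY p' insert.prems by blast
      \<comment> \<open>The point \<open>g\<close> links the two colours: it is collinear with
        \<open>e\<close> and \<open>p'\<close>, which is covered by induction, and with
        \<open>f\<close> and \<open>x\<close>, which is covered by \<open>lines\<close>.\<close>
      obtain g where g: "g \<in> cl {f, x}" "g \<in> cl {e, p'}"
        using pasch[OF eg pg(1) pg(2) insert.prems(7) x fx ep'] .
      have "g \<notin> cl X"
      proof (cases "g \<in> cl {x}")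
        case False
        then show ?thesis
          using line_leaves_flat[OF FX _ fg _ g(1)] insert.prems XclX xX by blast
      next
        case True
        \<comment> \<open>If \<open>g\<close> were parallel to both \<open>x\<close> and
          \<open>p'\<close>, then \<open>x\<close>, and with it \<open>p\<close>, would already lie
          in the closure of \<open>Y\<close>.\<close>
        have "g \<notin> cl {p'}"
        proof
          assume "g \<in> cl {p'}"
          then have gY: "g \<in> cl Y" using in_flat_point[OF FY p'(1)] by auto
          have "x \<in> cl {g}" using in_cl_singleton_sym[OF xg True] .
          then have "x \<in> cl Y" using in_flat_point[OF FY gY] by auto
          then show False using in_flat_line[OF FY p'(1) _ p'(2)] False \<open>\<not> (p \<in> cl Y \<or> p \<in> cl {x})\<close> by auto
        qed
        then show ?thesis
          using line_leaves_flat[OF FX _ eg _ g(2)] insert.prems clY p' by blast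
      qed
      moreover have "g \<in> G" using in_flat_line[OF G _ _ g(2)] insert.prems p' clY clXG by blast
      ultimately have "c e = c g" "c f = c g"
        using IH[OF YX p'(1), of e g] lines[OF xX, of f g] insert.prems g by auto
      then show ?thesis by simp
    qed
  qed
  show ?thesis
    unfolding homogeneous_def
  proof (intro ballI impI)
    fix e f assume e: "e \<in> G - cl X" and f: "f \<in> G - cl X" "f \<in> cl (insert e (cl X))"
    have eg: "e \<in> ground M" using e Gg by auto
    show "c e = c f"
    proof (cases "f \<in> cl {e}")
      case True
      then show ?thesis using cl_singleton_colour eg by metis
    next
      case False
      then obtain p where "p \<in> cl X" "f \<in> cl {p, e}" using line_through_apex[OF FX eg f(2)] by blast
      then show ?thesis using main[OF \<open>finite X\<close> subset_refl, of p e f] e f by (simp add: insert_commute)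
    qed
  qed
qed

text \<open>Elements outside this span have colours in \<open>S\<close>. On a line through an
  \<open>x\<close> whose colour is not in \<open>S\<close>, two such colours must agree, since no
  line is rainbow.\<close>

lemma homogeneous_other_colours:
  assumes G: "flat M G"
  shows "homogeneous G (cl {x \<in> G. c x \<notin> S})"
proof (rule homogeneous_cl[OF G])
  let ?X = "{x \<in> G. c x \<notin> S}"
  fix x e f assume x: "x \<in> ?X" and e: "e \<in> G" "e \<notin> cl ?X" and f: "f \<in> G" "f \<notin> cl ?X" "f \<in> cl {e, x}"
  have "?X \<subseteq> cl ?X" by (rule subset_cl) (use G flat_ground in auto)
  then have "c e \<in> S" "c f \<in> S" using e f by auto
  moreover have "e \<in> ground M" "x \<in> ground M" using e x G flat_ground by auto
  ultimately show "c e = c f" using no_rainbow_line[of e x f] x f by auto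
qed auto

section \<open>Peeling off a layer with at most two colours\<close>

definition peelable :: "'a set \<Rightarrow> bool" where
  "peelable G \<longleftrightarrow> (\<exists>F. flat M F \<and> F \<subset> G \<and> card (c ` (G - F)) \<le> 2)"

lemma peelableI:
  assumes "flat M F" "F \<subset> G" "\<And>x. x \<in> G \<Longrightarrow> x \<notin> F \<Longrightarrow> c x = a \<or> c x = b"
  shows "peelable G"
proof -
  have "c ` (G - F) \<subseteq> {a, b}" using assms by auto
  then have "card (c ` (G - F)) \<le> card {a, b}" by (rule card_mono[rotated]) simp
  also have "\<dots> \<le> 2" by (simp add: card_insert_if)
  finally show ?thesis using assms by (auto simp: peelable_def)
qed

text \<open>Projection from \<open>F\<close> onto a complement \<open>D\<close> preserves colours.
  Hence if \<open>D\<close> peels to \<open>F'\<close>, then \<open>G\<close> peels to the span of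
  \<open>F\<close> and \<open>F'\<close>.\<close>

lemma peelable_of_homogeneous:
  assumes G: "flat M G" and F: "flat M F" "F \<subset> G" "F \<noteq> {}" and hom: "homogeneous G F"
    and smaller: "\<And>H. \<lbrakk>flat M H; H \<subseteq> G; rank M H < rank M G; H \<noteq> {}\<rbrakk> \<Longrightarrow> peelable H"
  shows "peelable G"
proof -
  have FG: "F \<subseteq> G" using F by auto
  obtain D where D: "flat M D" "D \<subseteq> G" "F \<inter> D = {}" "cl (F \<union> D) = G" "rank M F + rank M D = rank M G"
    using flat_complement[OF F(1) G FG] .
  have rF: "rank M F > 0" using rank_pos[of F] F G flat_ground by auto
  have "D \<noteq> {}" using D(5) flat_psubset_rank[OF F(1) G F(2)] by auto
  moreover have "rank M D < rank M G" using D rF by linarith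
  ultimately have "peelable D" using smaller[OF D(1,2)] by simp
  then obtain F' where F': "flat M F'" "F' \<subset> D" "card (c ` (D - F')) \<le> 2"
    unfolding peelable_def by auto
  have sub: "F \<union> F' \<subseteq> ground M" using F F' flat_ground by blast
  define K where "K = cl (F \<union> F')"
  have K: "flat M K" using sub by (auto simp: K_def)
  have FK: "F \<union> F' \<subseteq> K" using subset_cl[OF sub] by (simp add: K_def)
  have KG: "K \<subseteq> G" unfolding K_def by (rule cl_least) (use G F F' D in auto)
  have "rank M K \<le> rank M F + rank M F'" using rank_cl[OF sub] rank_Un_le by (simp add: K_def)
  also have "\<dots> < rank M G" using D(5) flat_psubset_rank[OF F'(1) D(1) F'(2)] by simp
  finally have "K \<noteq> G" by auto
  have "c ` (G - K) \<subseteq> c ` (D - F')"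
  proof (rule image_subsetI)
    fix w assume w: "w \<in> G - K"
    then have wF: "w \<notin> F" "w \<in> ground M" using FK G flat_ground by auto
    have ins: "insert w F \<subseteq> ground M" using wF F flat_ground by auto
    have "rank M (cl (insert w F)) = rank M F + 1" using rank_cl[OF ins] rank_insert_flat F wF by simp
    \<comment> \<open>The point \<open>g\<close> is the projection of \<open>w\<close> from
      \<open>F\<close> onto \<open>D\<close>.\<close>
    then obtain g where g: "g \<in> cl (insert w F)" "g \<in> D"
      using flats_meet[OF flat_cl[OF ins] D(1) _ D(2) G] cl_least[OF G, of "insert w F"] w FG D(5)
      by auto
    have gF: "g \<notin> F" using g D by auto
    have "g \<notin> F'"
    proof
      assume "g \<in> F'"
      then have "insert g F \<subseteq> K" using FK by auto
      then have "cl (insert g F) \<subseteq> K" using cl_least[OF K] by auto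
      moreover have "w \<in> cl (insert g F)"
        using cl_exchange[of F w g] g gF wF F flat_ground flat_cl_eq by auto
      ultimately show False using w by auto
    qed
    moreover have "c w = c g" using homogeneousD[OF hom _ wF(1) _ gF g(1)] w g D by auto
    ultimately show "c w \<in> c ` (D - F')" using g by auto
  qed
  moreover have "finite D" using flat_ground[OF D(1)] ground_finite by (rule finite_subset)
  ultimately have "card (c ` (G - K)) \<le> card (c ` (D - F'))" by (intro card_mono) auto
  then have "card (c ` (G - K)) \<le> 2" using F'(3) by simp
  moreover have "K \<subset> G" using KG \<open>K \<noteq> G\<close> by auto
  ultimately show ?thesis using K unfolding peelable_def by blast
qed

text \<open>Outside \<open>H\<close>, consider the points not coloured \<open>a\<close> and the
  hyperplanes of \<open>G\<close> through \<open>K\<close> containing them. With no such point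
  \<open>H\<close> is peeled to, with one such hyperplane that hyperplane, and with several the flat
  \<open>K\<close>.\<close>

lemma peelable_of_monochromatic_affine:
  assumes G: "flat M G" and H: "flat M H" "H \<subseteq> G" "rank M G = rank M H + 1"
    and K: "flat M K" "K \<subseteq> H" "rank M H = rank M K + 1"
    and mono: "\<And>x. x \<in> H \<Longrightarrow> x \<notin> K \<Longrightarrow> c x = a"
  shows "peelable G"
proof -
  have Gg: "G \<subseteq> ground M" using G flat_ground by auto
  \<comment> \<open>The line through \<open>z\<close> and \<open>w\<close> meets \<open>H\<close> in
    a point off \<open>K\<close>, which has colour \<open>a\<close>; as the line is not rainbow,
    \<open>z\<close> and \<open>w\<close> agree.\<close>
  have same: "c z = c w" if z: "z \<in> G" "z \<notin> H" "c z \<noteq> a" and w: "w \<in> G" "w \<notin> H" "c w \<noteq> a"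
      and nw: "w \<notin> cl (insert z K)" for z w
  proof -
    have zw: "z \<in> ground M" "w \<in> ground M" using z w Gg by auto
    have "w \<notin> cl {z}" using cl_mono[of "{z}" "insert z K"] nw by auto
    then have r: "rank M (cl {z, w}) = 2" using rank_pair[OF zw] rank_cl[of "{z, w}"] zw by simp
    have "cl {z, w} \<subseteq> G" by (rule cl_least) (use G z w in auto)
    then obtain p where p: "p \<in> H" "p \<in> cl {z, w}"
      using flats_meet[OF H(1) _ H(2) _ G, of "cl {z, w}"] r H zw by auto
    have "p \<notin> K"
    proof
      assume pK: "p \<in> K"
      have "p \<notin> cl {z}"
      proof
        assume "p \<in> cl {z}"
        then have "z \<in> cl {p}" using in_cl_singleton_sym zw by auto
        then show False using in_flat_point[OF H(1) p(1)] z by auto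
      qed
      then have "w \<in> cl {p, z}" using in_line_exchange[OF zw(2,1)] p by (simp add: insert_commute)
      then show False using nw cl_mono[of "{p, z}" "insert z K"] pK by auto
    qed
    then have "c p = a" using mono p by auto
    then show ?thesis using no_rainbow_line[OF zw p(2)] z w by auto
  qed
  show ?thesis
  proof (cases "\<exists>z\<in>G - H. c z \<noteq> a")
    case False
    have "H \<subset> G" using H by auto
    then show ?thesis using False by (intro peelableI[OF H(1), of G a a]) auto
  next
    case True
    then obtain z where z: "z \<in> G" "z \<notin> H" "c z \<noteq> a" by auto
    have sub: "insert z K \<subseteq> ground M" using z Gg K flat_ground by auto
    let ?Q = "cl (insert z K)"
    have QG: "?Q \<subseteq> G" by (rule cl_least) (use G z K H in auto)
    have KQ: "K \<subseteq> ?Q" using subset_cl[OF sub] by auto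
    show ?thesis
    proof (cases "\<exists>w\<in>G - H. c w \<noteq> a \<and> w \<notin> ?Q")
      case True
      then obtain w where w: "w \<in> G" "w \<notin> H" "c w \<noteq> a" "w \<notin> ?Q" by auto
      have zw: "c z = c w" using same[OF z w] .
      have "K \<subset> G" using K H z by auto
      moreover have "c v = a \<or> c v = c z" if v: "v \<in> G" "v \<notin> K" for v
      proof (cases "v \<in> H \<or> c v = a")
        case True
        then show ?thesis using mono v by auto
      next
        case False
        show ?thesis
        proof (cases "v \<in> ?Q")
          case True
          \<comment> \<open>A point \<open>v\<close> in the same hyperplane as \<open>z\<close> is
            compared with \<open>w\<close>, which lies in another one.\<close>
          then have "cl (insert v K) \<subseteq> ?Q" using KQ sub by (intro cl_least) auto
          then show ?thesis using same[of v w] v False w zw by auto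
        next
          case nQ: False
          then show ?thesis using same[of z v] v False z by auto
        qed
      qed
      ultimately show ?thesis by (rule peelableI[OF K(1)])
    next
      case False
      have "rank M ?Q \<le> rank M K + 1" using rank_cl[OF sub] rank_insert_le by simp
      then have "?Q \<noteq> G" using H K by auto
      then have "?Q \<subset> G" using QG by auto
      moreover have "c v = a \<or> c v = a" if v: "v \<in> G" "v \<notin> ?Q" for v
        using v False mono KQ by blast
      ultimately show ?thesis using sub by (intro peelableI[of ?Q G a a]) auto
    qed
  qed
qed

text \<open>If some line with two classes had only one point of one of them, the rest of that line
  would be monochromatic and \<open>G\<close> peelable. Otherwise the plane satisfies the hypotheses
  of \<open>no_tricoloured_plane\<close>.\<close>

lemma peelable_plane:
  assumes G: "flat M G" "rank M G = 3" and ab: "a \<in> c ` G" "b \<in> c ` G" "a \<noteq> b" and d: "d \<in> c ` G" "d \<noteq> a" "d \<noteq> b"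
  shows "peelable G"
proof (rule ccontr)
  assume not_peelable: "\<not> peelable G"
  have Gg: "G \<subseteq> ground M" using G flat_ground by auto
  \<comment> \<open>Points of the plane are parallel classes, since parallel elements would violate
    the uniqueness of lines.\<close>
  define pt where "pt x = cl {x}" for x
  define Ls where "Ls = {pt ` L | L. flat M L \<and> L \<subseteq> G \<and> rank M L = 2}"
  have pt_self: "x \<in> pt x" if "x \<in> G" for x
    using subset_cl[of "{x}"] that Gg by (auto simp: pt_def)
  have pt_colour: "c x = c y" if "x \<in> G" "y \<in> G" "pt x = pt y" for x y
    using cl_singleton_colour[of y x] pt_self[of x] that Gg by (auto simp: pt_def)
  have pt_mem: "x \<in> L" if xL: "x \<in> G" "flat M L" "pt x \<in> pt ` L" for x L
  proof -
    obtain y where y: "y \<in> L" "pt x = pt y" using xL(3) by auto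
    then show ?thesis using in_flat_point[OF xL(2) y(1)] pt_self[OF xL(1)] by (auto simp: pt_def)
  qed
  have pt_neq: "y \<notin> cl {x}" if "x \<in> G" "y \<in> G" "pt x \<noteq> pt y" for x y
  proof
    assume y: "y \<in> cl {x}"
    then have "x \<in> cl {y}" using in_cl_singleton_sym that Gg by auto
    moreover have "flat M (cl {x})" "flat M (cl {y})" using that Gg by auto
    ultimately have "cl {x} \<subseteq> cl {y}" "cl {y} \<subseteq> cl {x}"
      using y cl_least[of "cl {y}" "{x}"] cl_least[of "cl {x}" "{y}"] by simp_all
    then show False using that by (auto simp: pt_def)
  qed
  have line: "cl {x, y} = L" if "flat M L" "rank M L = 2" "x \<in> L" "y \<in> L" "y \<notin> cl {x}" for x y L
  proof (rule flat_subset_rank_eq)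
    have xy: "x \<in> ground M" "y \<in> ground M" using that flat_ground by auto
    then show "flat M (cl {x, y})" by auto
    show "rank M L \<le> rank M (cl {x, y})" using rank_cl[of "{x, y}"] rank_pair[OF xy] xy that by simp
  qed (use that cl_least in auto)
  interpret finite_plane "pt ` G" Ls
  proof
    show "finite (pt ` G)" using Gg ground_finite finite_subset by blast
    show "L \<subseteq> pt ` G" if "L \<in> Ls" for L using that by (auto simp: Ls_def)
  next
    fix X Y assume "X \<in> pt ` G" "Y \<in> pt ` G" "X \<noteq> Y"
    then obtain x y where xy: "x \<in> G" "y \<in> G" "X = pt x" "Y = pt y" "y \<notin> cl {x}" using pt_neq by auto
    then have g: "x \<in> ground M" "y \<in> ground M" using Gg by auto
    then have "x \<in> cl {x, y}" "y \<in> cl {x, y}" using subset_cl[of "{x, y}"] by auto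
    moreover have "cl {x, y} \<subseteq> G" using cl_least G xy by auto
    moreover have "rank M (cl {x, y}) = 2" using rank_cl[of "{x, y}"] rank_pair[OF g] g xy by simp
    ultimately show "\<exists>L\<in>Ls. X \<in> L \<and> Y \<in> L" using g xy unfolding Ls_def by blast
  next
    fix K L X Y assume *: "K \<in> Ls" "L \<in> Ls" "X \<in> K" "Y \<in> K" "X \<in> L" "Y \<in> L" "X \<noteq> Y"
    then obtain K' L' where K: "K = pt ` K'" "flat M K'" "K' \<subseteq> G" "rank M K' = 2"
      and L: "L = pt ` L'" "flat M L'" "L' \<subseteq> G" "rank M L' = 2" by (auto simp: Ls_def)
    obtain x y where xy: "x \<in> K'" "y \<in> K'" "X = pt x" "Y = pt y" using * K by auto
    have "y \<notin> cl {x}" using pt_neq xy * K by blast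
    moreover have "x \<in> L'" "y \<in> L'" using pt_mem xy * K L by blast+
    ultimately have "cl {x, y} = L'" "cl {x, y} = K'" using line K L xy by blast+
    then show "K = L" using K L by simp
  next
    fix K L assume "K \<in> Ls" "L \<in> Ls"
    then obtain K' L' where K: "K = pt ` K'" "flat M K'" "K' \<subseteq> G" "rank M K' = 2"
      and L: "L = pt ` L'" "flat M L'" "L' \<subseteq> G" "rank M L' = 2" by (auto simp: Ls_def)
    obtain p where "p \<in> K'" "p \<in> L'" using flats_meet[OF K(2) L(2) K(3) L(3) G(1)] K L G by auto
    then show "K \<inter> L \<noteq> {}" using K L by auto
  qed
  \<comment> \<open>All colours other than \<open>a\<close> and \<open>b\<close> are merged into
    class 2, which contains \<open>d\<close>. Merging creates no line with three classes, because
    distinct classes have distinct colours.\<close>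
  define \<kappa> where "\<kappa> x = (if c x = a then 0 else if c x = b then 1 else 2::nat)" for x
  have \<kappa>_cong: "\<kappa> x = \<kappa> y" if "c x = c y" for x y using that by (simp only: \<kappa>_def)
  define cls where "cls i = pt ` {x \<in> G. \<kappa> x = i}" for i
  have cls_mem: "pt x \<in> cls i \<longleftrightarrow> \<kappa> x = i" if "x \<in> G" for x i
  proof
    assume "pt x \<in> cls i"
    then obtain y where y: "y \<in> G" "\<kappa> y = i" "pt x = pt y" by (auto simp: cls_def)
    then show "\<kappa> x = i" using pt_colour that \<kappa>_cong by blast
  qed (use that in \<open>auto simp: cls_def\<close>)
  have cls_elim: "\<exists>x\<in>L. \<kappa> x = i" if L: "flat M L" "L \<subseteq> G" "pt ` L \<inter> cls i \<noteq> {}" for L i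
  proof -
    obtain x where "x \<in> L" "pt x \<in> cls i" using L(3) by auto
    then show ?thesis using cls_mem[of x i] L by auto
  qed
  have line_colours: "\<kappa> z = \<kappa> x \<or> \<kappa> z = \<kappa> y" if "flat M L" "L \<subseteq> G" "rank M L = 2"
     "x \<in> L" "y \<in> L" "z \<in> L" "\<kappa> x \<noteq> \<kappa> y" for L x y z
  proof -
    have xy: "x \<in> ground M" "y \<in> ground M" using that Gg by auto
    have cxy: "c x \<noteq> c y" using that \<kappa>_cong by blast
    then have "y \<notin> cl {x}" using cl_singleton_colour[of x y] xy by auto
    then have "z \<in> cl {x, y}" using line[of L x y] that by auto
    then show ?thesis using no_rainbow_line[OF xy] cxy \<kappa>_cong by blast
  qed
  have tri: "tricoloured (cls 0) (cls 1) (cls 2)"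
    unfolding tricoloured_def
  proof (intro conjI ballI)
    show "cls 0 \<union> cls 1 \<union> cls 2 = pt ` G"
      by (auto simp: cls_def \<kappa>_def)
    have disj: "cls i \<inter> cls j = {}" if "i \<noteq> j" for i j
    proof (rule ccontr)
      assume "cls i \<inter> cls j \<noteq> {}"
      then obtain x where "x \<in> G" "pt x \<in> cls i" "pt x \<in> cls j" by (auto simp: cls_def)
      then show False using cls_mem[of x] \<open>i \<noteq> j\<close> by simp
    qed
    show "cls 0 \<inter> cls 1 = {}" "cls 0 \<inter> cls 2 = {}" "cls 1 \<inter> cls 2 = {}"
      by (rule disj; simp)+
    fix L assume "L \<in> Ls"
    then obtain L' where L: "L = pt ` L'" "flat M L'" "L' \<subseteq> G" "rank M L' = 2" by (auto simp: Ls_def)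
    show "L \<inter> cls 0 = {} \<or> L \<inter> cls 1 = {} \<or> L \<inter> cls 2 = {}"
    proof (rule ccontr)
      assume "\<not> ?thesis"
      then obtain x y z where "x \<in> L'" "y \<in> L'" "z \<in> L'" "\<kappa> x = 0" "\<kappa> y = 1" "\<kappa> z = 2"
        using cls_elim[OF L(2,3)] L(1) by metis
      then show False using line_colours[OF L(2-4), of x y z] by simp
    qed
  qed
  have ne: "cls 0 \<noteq> {}" "cls 1 \<noteq> {}" "cls 2 \<noteq> {}"
    using ab d by (auto simp: cls_def \<kappa>_def)
  have two': "2 \<le> card (L \<inter> cls i)"
    if Lij: "L \<in> Ls" "i \<noteq> j" "L \<inter> cls i \<noteq> {}" "L \<inter> cls j \<noteq> {}" for L i j
  proof (rule ccontr)
    assume less: "\<not> ?thesis"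
    obtain L' where L: "L = pt ` L'" "flat M L'" "L' \<subseteq> G" "rank M L' = 2"
      using Lij(1) by (auto simp: Ls_def)
    obtain x y where x: "x \<in> L'" "\<kappa> x = i" and y: "y \<in> L'" "\<kappa> y = j"
      using cls_elim[OF L(2,3)] L(1) Lij(3,4) by metis
    have xy: "x \<in> ground M" "y \<in> ground M" "x \<in> G" using x y L Gg by auto
    have "c x \<noteq> c y" using x y Lij(2) \<kappa>_cong by blast
    then have yx: "y \<notin> cl {x}" using cl_singleton_colour[of x y] xy by auto
    have single: "X = pt x" if "X \<in> L \<inter> cls i" for X
    proof (rule ccontr)
      assume "X \<noteq> pt x"
      moreover have "pt x \<in> L \<inter> cls i" using x L cls_mem[OF xy(3)] by auto
      ultimately have "card {X, pt x} \<le> card (L \<inter> cls i)"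
        using that finite_line[OF \<open>L \<in> Ls\<close>] by (intro card_mono) auto
      then show False using less \<open>X \<noteq> pt x\<close> by simp
    qed
    \<comment> \<open>As \<open>pt x\<close> is the only point of its class on the line, the
      elements off that point all have the other colour; the closure of \<open>x\<close> then acts
      as \<open>K\<close> for the line \<open>L'\<close>.\<close>
    have "c u = c y" if u: "u \<in> L'" "u \<notin> cl {x}" for u
    proof -
      have uG: "u \<in> G" using u L by auto
      have "u \<in> cl {x, y}" using line[OF L(2,4) x(1) y(1) yx] u by auto
      then have "c u = c x \<or> c u = c y" using no_rainbow_line[OF xy(1,2)] \<open>c x \<noteq> c y\<close> by auto
      moreover have "c u \<noteq> c x"
      proof
        assume "c u = c x"
        then have "pt u \<in> L \<inter> cls i" using x u L cls_mem[OF uG] \<kappa>_cong[of u x] by auto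
        then have "pt u = pt x" by (rule single)
        then show False using pt_self[OF uG] u by (auto simp: pt_def)
      qed
      ultimately show ?thesis by simp
    qed
    moreover have "cl {x} \<subseteq> L'" using cl_least[OF L(2)] x by auto
    moreover have "rank M (cl {x}) = 1" using rank_cl[of "{x}"] rank_singleton xy by auto
    ultimately have "peelable G"
      using peelable_of_monochromatic_affine[OF G(1) L(2,3) _ flat_cl[of "{x}"], of "c y"] L G xy by auto
    then show False using not_peelable by simp
  qed
  have "2 \<le> card (L \<inter> X)" if LXY: "L \<in> Ls" "X \<in> {cls 0, cls 1, cls 2}" "Y \<in> {cls 0, cls 1, cls 2}" "X \<noteq> Y"
     "L \<inter> X \<noteq> {}" "L \<inter> Y \<noteq> {}" for L X Y
  proof -
    obtain i j where "X = cls i" "Y = cls j" using LXY(2,3) by blast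
    then show ?thesis using two'[of L i j] LXY by auto
  qed
  then show False using no_tricoloured_plane[OF tri ne] by blast
qed

text \<open>A homogeneous flat \<open>F\<close> of a hyperplane \<open>H\<close>, chosen maximal, is extended by a point \<open>z\<close> outside \<open>H\<close> which
  witnesses that the span of the other colours of \<open>H\<close> is not a homogeneous flat of \<open>G\<close>.\<close>

lemma peelable_step:
  assumes G: "flat M G" "4 \<le> rank M G"
    and x: "x1 \<in> G" "x2 \<in> G" "x3 \<in> G" "c x1 \<noteq> c x2" "c x1 \<noteq> c x3" "c x2 \<noteq> c x3"
    and smaller: "\<And>H. \<lbrakk>flat M H; H \<subseteq> G; rank M H < rank M G; H \<noteq> {}\<rbrakk> \<Longrightarrow> peelable H"
  shows "peelable G"
proof (rule ccontr)
  assume not_peelable: "\<not> peelable G"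
  have Gg: "G \<subseteq> ground M" using G flat_ground by auto
  have xg: "{x1, x2, x3} \<subseteq> ground M" using x Gg by auto
  have "rank M (cl {x1, x2, x3}) \<le> 3"
    using rank_cl[OF xg] rank_insert_le[of x1 "{x2, x3}"] rank_pair_le[of x2 x3] by simp
  then have r: "rank M (cl {x1, x2, x3}) \<le> rank M G - 1" using G by simp
  have "cl {x1, x2, x3} \<subseteq> G" by (rule cl_least) (use G x in auto)
  \<comment> \<open>Rank at least 4 leaves room for a hyperplane that still contains three
    colours.\<close>
  then obtain H where H: "flat M H" "cl {x1, x2, x3} \<subseteq> H" "H \<subseteq> G" "rank M H = rank M G - 1"
    using extend_flat[OF flat_cl[OF xg] G(1) _ r] by auto
  have xH: "x1 \<in> H" "x2 \<in> H" "x3 \<in> H" using H subset_cl[OF xg] by auto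
  have rGH: "rank M G = rank M H + 1" using H G by simp
  have Hg: "H \<subseteq> ground M" using H Gg by auto
  have finH: "finite H" using Hg ground_finite finite_subset by blast
  define good where
    "good F \<longleftrightarrow> flat M F \<and> F \<subset> H \<and> card (c ` (H - F)) \<le> 2 \<and> homogeneous H F" for F
  have "peelable H" using smaller[OF H(1,3)] xH rGH by auto
  then obtain F1 where F1: "flat M F1" "F1 \<subset> H" "card (c ` (H - F1)) \<le> 2" by (auto simp: peelable_def)
  \<comment> \<open>Shrinking \<open>F1\<close> to the span of the elements whose colours do not
    occur outside \<open>F1\<close> makes it homogeneous and adds no colour outside.\<close>
  define F2 where "F2 = cl {x \<in> H. c x \<notin> c ` (H - F1)}"
  have "flat M F2" unfolding F2_def using Hg by (intro flat_cl) auto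
  moreover have "F2 \<subseteq> F1" unfolding F2_def by (rule cl_least[OF F1(1)]) auto
  ultimately have F2: "flat M F2" "F2 \<subseteq> F1" by auto
  have "{x \<in> H. c x \<notin> c ` (H - F1)} \<subseteq> F2" unfolding F2_def by (rule subset_cl) (use Hg in auto)
  then have "c ` (H - F2) \<subseteq> c ` (H - F1)" by auto
  then have "card (c ` (H - F2)) \<le> card (c ` (H - F1))" using finH by (intro card_mono) auto
  then have "good F2"
    using F1 F2 homogeneous_other_colours[OF H(1)] by (auto simp: good_def F2_def)
  moreover have "\<forall>F. good F \<longrightarrow> rank M F < rank M H"
    using flat_psubset_rank H(1) by (auto simp: good_def)
  ultimately obtain F where "good F" and F_max: "\<And>F'. good F' \<Longrightarrow> rank M F' \<le> rank M F"
    using ex_has_greatest_nat[of good F2 "rank M" "rank M H"] by auto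
  then have F: "flat M F" "F \<subset> H" "card (c ` (H - F)) \<le> 2" "homogeneous H F" by (auto simp: good_def)
  have FH: "F \<subseteq> H" using F by auto
  obtain e0 where e0: "e0 \<in> H" "e0 \<notin> F" using F by auto
  define \<alpha> where "\<alpha> = c e0"
  have "\<exists>f0\<in>H - F. c f0 \<noteq> \<alpha>"
  proof (rule ccontr)
    assume mono: "\<not> ?thesis"
    have "rank M F < rank M H" using flat_psubset_rank[OF F(1) H(1) F(2)] .
    then have "rank M F \<le> rank M H - 1" by simp
    from extend_flat[OF F(1) H(1) FH this]
    obtain K where K: "flat M K" "F \<subseteq> K" "K \<subseteq> H" "rank M K = rank M H - 1" by auto
    have "peelable G"
      by (rule peelable_of_monochromatic_affine[OF G(1) H(1,3) rGH K(1,3), of \<alpha>])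
        (use K mono \<open>rank M F < rank M H\<close> in auto)
    then show False using not_peelable by simp
  qed
  then obtain f0 where f0: "f0 \<in> H" "f0 \<notin> F" "c f0 \<noteq> \<alpha>" by auto
  define \<beta> where "\<beta> = c f0"
  have \<alpha>\<beta>: "\<alpha> \<noteq> \<beta>" using f0 by (simp add: \<beta>_def)
  have two_colours: "c u = \<alpha> \<or> c u = \<beta>" if "u \<in> H" "u \<notin> F" for u
  proof (rule ccontr)
    assume "\<not> ?thesis"
    then have "card {\<alpha>, \<beta>, c u} = 3" using \<alpha>\<beta> by auto
    moreover have "card {\<alpha>, \<beta>, c u} \<le> card (c ` (H - F))"
      using finH that e0 f0 by (intro card_mono) (auto simp: \<alpha>_def \<beta>_def)
    ultimately show False using F by simp
  qed
  \<comment> \<open>If \<open>F\<close> were a hyperplane of \<open>H\<close>, homogeneity would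
    give \<open>H - F\<close> a single colour.\<close>
  have rFH: "rank M F + 1 < rank M H"
  proof (rule ccontr)
    assume "\<not> ?thesis"
    then have "cl (insert e0 F) = H" using cl_insert_eq[OF F(1) H(1) FH e0] by simp
    then have "c e0 = c f0" using homogeneousD[OF F(4) e0 f0(1,2)] f0 by simp
    then show False using f0 by (simp add: \<alpha>_def)
  qed
  define X where "X = {x \<in> H. c x \<notin> {\<alpha>, \<beta>}}"
  have XH: "X \<subseteq> H" and Xg: "X \<subseteq> ground M" using Hg by (auto simp: X_def)
  have XF: "X \<subseteq> F" using two_colours by (auto simp: X_def)
  have F0: "flat M (cl X)" "cl X \<subseteq> F" using Xg cl_least[OF F(1) XF] by auto
  have hom0: "homogeneous H (cl X)" unfolding X_def by (rule homogeneous_other_colours[OF H(1)])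
  have "x1 \<in> X \<or> x2 \<in> X \<or> x3 \<in> X" using xH x by (auto simp: X_def)
  then have "cl X \<noteq> {}" using subset_cl[OF Xg] by auto
  moreover have "cl X \<subset> G" using F0 F H by auto
  \<comment> \<open>The flat spanned by \<open>X\<close> is nonempty because \<open>H\<close>
    carries a third colour, so homogeneity in \<open>G\<close> would make \<open>G\<close> peelable.
    The failure shows on a line through some \<open>p\<close> in \<open>X\<close>.\<close>
  ultimately have "\<not> homogeneous G (cl X)"
    using peelable_of_homogeneous[OF G(1) F0(1)] smaller not_peelable by blast
  then obtain p e f where p: "p \<in> X" and ef: "e \<in> G" "e \<notin> cl X" "f \<in> G" "f \<notin> cl X" "f \<in> cl {e, p}" "c e \<noteq> c f"
    using homogeneous_cl[OF G(1), of X] XH H by blast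
  have pX: "p \<in> cl X" using p subset_cl[OF Xg] by auto
  have pF: "p \<in> F" and pH: "p \<in> H" using p XF XH by auto
  have pg: "p \<in> ground M" using pH Hg by auto
  have off_p: "u \<notin> cl {p}" if "u \<notin> cl X" for u using in_flat_point[OF F0(1) pX] that by auto
  \<comment> \<open>Since the line through \<open>e\<close>, \<open>f\<close> and \<open>p\<close>
    is not rainbow, one of \<open>e\<close> and \<open>f\<close> has the colour of \<open>p\<close>;
    that one becomes \<open>z\<close>, the other \<open>z'\<close>.\<close>
  have "\<exists>z z'. z \<in> G - cl X \<and> z' \<in> G - cl X \<and> z' \<in> cl {z, p} \<and> c z = c p \<and> c z' \<noteq> c p"
  proof -
    have efg: "e \<in> ground M" "f \<in> ground M" using ef Gg by auto
    have "e \<in> cl {f, p}" by (rule in_line_exchange[OF efg(1) pg ef(5) off_p[OF ef(4)]])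
    then show ?thesis
      using no_rainbow_line[OF efg(1) pg ef(5)] ef by (cases "c e = c p") (metis DiffI)+
  qed
  then obtain z z' where z: "z \<in> G" "z \<notin> cl X" and z': "z' \<in> G" "z' \<notin> cl X" "z' \<in> cl {z, p}"
    and cz: "c z = c p" and cz': "c z' \<noteq> c p" by auto
  have zg: "z \<in> ground M" "z' \<in> ground M" using z z' Gg by auto
  have cp: "c p \<noteq> \<alpha>" "c p \<noteq> \<beta>" using p by (auto simp: X_def)
  have zz': "z \<in> cl {z', p}" by (rule in_line_exchange[OF zg(1) pg z'(3) off_p[OF z'(2)]])
  \<comment> \<open>Inside \<open>H\<close> the span of \<open>X\<close> is homogeneous, so the bad
    line cannot lie there.\<close>
  have zH: "z \<notin> H"
  proof
    assume "z \<in> H"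
    moreover have "z' \<in> H" using in_flat_line[OF H(1) \<open>z \<in> H\<close> pH z'(3)] .
    moreover have "z' \<in> cl (insert z (cl X))" using cl_mono[of "{z, p}" "insert z (cl X)"] pX z' by auto
    ultimately have "c z = c z'" using homogeneousD[OF hom0 _ z(2) _ z'(2)] by auto
    then show False using cz cz' by simp
  qed
  have z'H: "z' \<notin> H" using in_flat_line[OF H(1) _ pH zz'] zH by auto
  have off_line: "w \<notin> cl {z, p}" if h: "h \<in> H" "h \<notin> F" and w: "w \<in> cl {h, z}" "w \<notin> cl {z}" for h w
  proof
    assume "w \<in> cl {z, p}"
    have hg: "h \<in> ground M" using h Hg by auto
    have zp: "{z, p} \<subseteq> ground M" using zg pg by auto
    have "h \<in> cl {w, z}" by (rule in_line_exchange[OF hg zg(1) w])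
    then have "h \<in> cl {z, p}" using in_flat_line[OF flat_cl[OF zp] \<open>w \<in> cl {z, p}\<close>, of z] subset_cl[OF zp] by auto
    moreover have "h \<notin> cl {p}" using in_flat_point[OF F(1) pF] h by auto
    ultimately have "z \<in> cl {h, p}" using in_line_exchange[OF zg(1) pg] by auto
    then show False using in_flat_line[OF H(1) h(1) pH] zH by auto
  qed
  \<comment> \<open>A different colour at \<open>w\<close> would have to be that of
    \<open>p\<close>. Pasch then gives \<open>q\<close> on the lines through \<open>w\<close>,
    \<open>z'\<close> and through \<open>h\<close>, \<open>p\<close>; homogeneity of
    \<open>F\<close> gives \<open>q\<close> the colour of \<open>h\<close>, and \<open>w\<close>,
    \<open>z'\<close>, \<open>q\<close> are rainbow.\<close>
  have claim1: "c w = c h" if h: "h \<in> H" "h \<notin> F" "c h \<noteq> c z'" and w: "w \<in> cl {h, z}" "w \<notin> cl {z}" for h w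
  proof (rule ccontr)
    assume cw: "c w \<noteq> c h"
    have hg: "h \<in> ground M" and wg: "w \<in> ground M" using h Hg w cl_ground by auto
    have hp: "c h \<noteq> c p" using two_colours[OF h(1,2)] cp by auto
    have cwp: "c w = c p" using no_rainbow_line[OF hg zg(1) w(1)] hp cz cw by auto
    have zp: "flat M (cl {z, p})" "{z, p} \<subseteq> cl {z, p}" using zg pg subset_cl[of "{z, p}"] by auto
    have wzp: "w \<notin> cl {z, p}" using off_line[OF h(1,2) w] .
    then have "w \<notin> cl {z'}" using in_flat_point[OF zp(1) z'(3)] by auto
    moreover have hcp: "h \<notin> cl {p}" using in_flat_point[OF F(1) pF] h by auto
    moreover have "z' \<in> cl {p, z}" using z' by (simp add: insert_commute)
    ultimately obtain q where q: "q \<in> cl {w, z'}" "q \<in> cl {h, p}" using pasch[OF hg zg(1) pg w(1)] by blast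
    have "q \<notin> cl {p}"
    proof
      assume "q \<in> cl {p}"
      then have "p \<in> cl {q}" using in_cl_singleton_sym pg by auto
      moreover have "{w, z'} \<subseteq> ground M" using wg zg by auto
      ultimately have "p \<in> cl {w, z'}" using in_flat_point[OF flat_cl q(1)] by auto
      moreover have "p \<notin> cl {z'}"
      proof
        assume "p \<in> cl {z'}"
        then have "z' \<in> cl {p}" using in_cl_singleton_sym zg by auto
        then show False using off_p z' by auto
      qed
      ultimately have "w \<in> cl {p, z'}" using in_line_exchange[OF wg zg(2)] by auto
      then show False using in_flat_line[OF zp(1) _ z'(3)] zp wzp by auto
    qed
    then have "q \<notin> F" using line_leaves_flat[OF F(1) pF hg h(2) q(2)] by auto
    moreover have "q \<in> H" using in_flat_line[OF H(1) h(1) pH q(2)] .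
    moreover have "q \<in> cl (insert h F)" using q cl_mono[of "{h, p}" "insert h F"] pF by auto
    ultimately have "c h = c q" using homogeneousD[OF F(4) h(1,2)] by auto
    then show False using no_rainbow_line[OF wg zg(2) q(1)] cwp cz' h hp by auto
  qed
  \<comment> \<open>Maximality of \<open>F\<close> enters here: the span of \<open>h\<close> and
    \<open>F\<close> is still proper in \<open>H\<close> by \<open>rFH\<close>, with at most two
    colours outside, so it fails to be homogeneous. The failure is moved by Pasch onto a line
    through \<open>h\<close>.\<close>
  have swap: "\<exists>h1 g. h1 \<in> H \<and> h1 \<notin> F \<and> c h1 \<noteq> c h \<and> g \<in> cl {h1, h} \<and> g \<notin> cl {h} \<and> c g = c h"
    if h: "h \<in> H" "h \<notin> F" for h
  proof -
    have hg: "h \<in> ground M" using h Hg by auto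
    have hF: "insert h F \<subseteq> ground M" using h Hg FH by auto
    define F' where "F' = cl (insert h F)"
    have F': "flat M F'" "insert h F \<subseteq> F'" "F' \<subseteq> H"
      unfolding F'_def using hF subset_cl[OF hF] cl_least[OF H(1), of "insert h F"] h FH by auto
    have rF': "rank M F' = rank M F + 1" unfolding F'_def using rank_cl[OF hF] rank_insert_flat[OF F(1) hg h(2)] by simp
    then have "F' \<subset> H" using F' rFH by auto
    have "c ` (H - F') \<subseteq> c ` (H - F)" using F' by auto
    then have "card (c ` (H - F')) \<le> card (c ` (H - F))" using finH by (intro card_mono) auto
    moreover have "\<not> good F'" using F_max[of F'] rF' by auto
    ultimately have "\<not> homogeneous H F'" using F' F \<open>F' \<subset> H\<close> by (auto simp: good_def)
    then obtain e f where ef: "e \<in> H" "e \<notin> F'" "f \<in> H" "f \<notin> F'" "f \<in> cl (insert e F')" "c e \<noteq> c f"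
      by (auto simp: homogeneous_def)
    have "e \<in> cl (insert f F')"
      using cl_exchange[of F' e f] ef F' Hg flat_cl_eq[OF F'(1)] by auto
    moreover have "e \<notin> F" "f \<notin> F" using ef F' by auto
    then have "c e = c h \<or> c f = c h" using two_colours[of e] two_colours[of f] two_colours[of h] h ef F' by auto
    ultimately have "\<exists>e f. e \<in> H - F' \<and> f \<in> H - F' \<and> f \<in> cl (insert e F') \<and> c e \<noteq> c h \<and> c f = c h"
      using ef by (metis DiffI)
    then obtain e f where e: "e \<in> H" "e \<notin> F'" "c e \<noteq> c h" and f: "f \<in> H" "f \<notin> F'" "f \<in> cl (insert e F')" "c f = c h"
      by auto
    have eg: "e \<in> ground M" and fg: "f \<in> ground M" using e f Hg by auto
    have eF: "e \<notin> F" and fF: "f \<notin> F" using e f F' by auto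
    have hF'': "h \<in> F'" using F' by auto
    have "f \<notin> cl {e}" using cl_singleton_colour[OF eg, of f] e f by auto
    then obtain g where g: "g \<in> F'" "f \<in> cl {g, e}" "g \<in> cl {f, e}"
      using line_through_apex[OF F'(1) eg f(3)] by blast
    have gH: "g \<in> H" using g F' by auto
    \<comment> \<open>A point \<open>g\<close> of \<open>F\<close> would put \<open>e\<close> and
      \<open>f\<close> in the same class modulo \<open>F\<close>, although their colours
      differ.\<close>
    have gF: "g \<notin> F"
    proof
      assume "g \<in> F"
      then have "f \<in> cl (insert e F)" using cl_mono[of "{g, e}" "insert e F"] g by auto
      then show False using homogeneousD[OF F(4) e(1) eF f(1) fF] e f by auto
    qed
    have gg: "g \<in> ground M" using gH Hg by auto
    have eh: "flat M (cl {e, h})" "{e, h} \<subseteq> cl {e, h}" using eg hg subset_cl[of "{e, h}"] by auto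
    have ecl: "e \<notin> cl {h}" using in_flat_point[OF F'(1) hF''] e by auto
    show ?thesis
    proof (cases "g \<in> cl {h}")
      case True
      then have "g \<in> cl {e, h}" using in_flat_point[OF eh(1)] eh(2) by auto
      then have "f \<in> cl {e, h}" using in_flat_line[OF eh(1) _ _ g(2)] eh by auto
      moreover have "f \<notin> cl {h}" using in_flat_point[OF F'(1) hF''] f by auto
      ultimately show ?thesis using e eF f by blast
    next
      case False
      then obtain p0 where p0: "p0 \<in> F" "g \<in> cl {p0, h}" "p0 \<in> cl {g, h}"
        using line_through_apex[OF F(1) hg, of g] g by (auto simp: F'_def)
      have p0g: "p0 \<in> ground M" using p0 FH Hg by auto
      have hp0: "h \<notin> cl {p0}" and fp0: "f \<notin> cl {p0}"
        using in_flat_point[OF F(1) p0(1)] h fF by auto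
      have f': "f \<in> cl {e, g}" and p0': "p0 \<in> cl {h, g}"
        using g p0 by (simp_all add: insert_commute)
      \<comment> \<open>Here \<open>q\<close> replaces \<open>f\<close>: it lies on the line through
        \<open>e\<close> and \<open>h\<close>, and it keeps the colour of \<open>f\<close> because
        the line through \<open>f\<close> and \<open>q\<close> meets \<open>F\<close> in
        \<open>p0\<close>.\<close>
      obtain q where q: "q \<in> cl {f, p0}" "q \<in> cl {e, h}"
        using pasch[OF eg gg hg f' p0' fp0 ecl] .
      have "q \<notin> cl {p0}"
      proof
        assume "q \<in> cl {p0}"
        then have "p0 \<in> cl {q}" using in_cl_singleton_sym p0g by auto
        then have p0eh: "p0 \<in> cl {e, h}" using in_flat_point[OF eh(1) q(2)] by auto
        have "p0 \<notin> cl {h}"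
        proof
          assume "p0 \<in> cl {h}"
          then have "h \<in> cl {p0}" using in_cl_singleton_sym hg by auto
          then show False using hp0 by simp
        qed
        then show False using line_leaves_flat[OF F'(1) hF'' eg e(2) p0eh] p0 F' by auto
      qed
      then have qF: "q \<notin> F" using line_leaves_flat[OF F(1) p0(1) fg fF q(1)] by auto
      have qH: "q \<in> H" using in_flat_line[OF H(1) f(1) _ q(1)] p0 FH by auto
      have "q \<in> cl (insert f F)" using q cl_mono[of "{f, p0}" "insert f F"] p0 by auto
      then have "c f = c q" using homogeneousD[OF F(4) f(1) fF qH qF] by auto
      moreover have "q \<notin> cl {h}"
      proof
        assume "q \<in> cl {h}"
        then have "h \<in> cl {q}" using in_cl_singleton_sym hg by auto
        moreover have "{f, p0} \<subseteq> ground M" using fg p0g by auto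
        ultimately have "h \<in> cl {f, p0}" using in_flat_point[OF flat_cl q(1)] by auto
        then have "f \<in> cl {h, p0}" using in_line_exchange[OF fg p0g _ hp0] by auto
        then show False using in_flat_line[OF F'(1) hF''] p0 F' f by blast
      qed
      ultimately show ?thesis using e eF q f by auto
    qed
  qed
  have claim2: "c w = \<alpha> \<or> c w = \<beta>" if h: "h \<in> H" "h \<notin> F" and w: "w \<in> cl {h, z}" "w \<notin> cl {z}" for h w
  proof (cases "c h = c z'")
    case False
    then show ?thesis using claim1[OF h _ w] two_colours[OF h] by auto
  next
    case True
    have hg: "h \<in> ground M" and wg: "w \<in> ground M" using h Hg w cl_ground by auto
    show ?thesis
    proof (rule ccontr)
      assume "\<not> ?thesis"
      then have cw: "c w = c p" using no_rainbow_line[OF hg zg(1) w(1)] two_colours[OF h] cz cp by auto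
      obtain h1 g where h1: "h1 \<in> H" "h1 \<notin> F" "c h1 \<noteq> c h" and g: "g \<in> cl {h1, h}" "g \<notin> cl {h}" "c g = c h"
        using swap[OF h] by blast
      have h1g: "h1 \<in> ground M" and gg: "g \<in> ground M" using h1 Hg g cl_ground by auto
      have gH: "g \<in> H" using in_flat_line[OF H(1) h1(1) h(1) g(1)] .
      have ch1: "c h1 \<noteq> c p" using two_colours[OF h1(1,2)] cp by auto
      have wzh: "w \<in> cl {z, h}" using w by (simp add: insert_commute)
      have wcg: "w \<notin> cl {g}" using cl_singleton_colour[OF gg, of w] cw g True cz' by auto
      have zch: "z \<notin> cl {h1}" using cl_singleton_colour[OF h1g, of z] cz ch1 by auto
      obtain v where v: "v \<in> cl {w, g}" "v \<in> cl {z, h1}"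
        using pasch[OF zg(1) hg h1g wzh g(1) wcg zch] .
      have "v \<notin> cl {z}"
      proof
        assume "v \<in> cl {z}"
        then have "z \<in> cl {v}" using in_cl_singleton_sym zg by auto
        moreover have "{w, g} \<subseteq> ground M" using wg gg by auto
        ultimately have "z \<in> cl {w, g}" using in_flat_point[OF flat_cl v(1)] by auto
        moreover have "z \<notin> cl {w}" using in_cl_singleton_sym[OF wg] w by auto
        ultimately have gzw: "g \<in> cl {z, w}" using in_line_exchange[OF gg wg, of z] by (simp add: insert_commute)
        have zh: "{z, h} \<subseteq> ground M" using zg hg by auto
        have "g \<in> cl {z, h}" using in_flat_line[OF flat_cl[OF zh] _ wzh gzw] subset_cl[OF zh] by auto
        then have "z \<in> cl {g, h}" using in_line_exchange[OF zg(1) hg _ g(2)] by auto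
        then show False using in_flat_line[OF H(1) gH h(1)] zH by auto
      qed
      moreover have "v \<in> cl {h1, z}" using v(2) by (simp add: insert_commute)
      moreover have "c h1 \<noteq> c z'" using h1(3) True by simp
      ultimately have "c v = c h1" using claim1[OF h1(1,2)] by blast
      then show False using no_rainbow_line[OF wg gg v(1)] cw ch1 g h1 True cz' by auto
    qed
  qed
  have zF: "insert z F \<subseteq> ground M" using zg FH Hg by auto
  \<comment> \<open>Outside \<open>K\<close> only \<alpha> and \<beta> remain: elements of
    \<open>H\<close> are then off \<open>F\<close>, and any other element lies on a line through
    \<open>z\<close> and a point of \<open>H - F\<close>, where \<open>claim2\<close>
    applies.\<close>
  define K where "K = cl (insert z F)"
  have K: "flat M K" "insert z F \<subseteq> K" "K \<subseteq> G"
    unfolding K_def using zF subset_cl[OF zF] cl_least[OF G(1), of "insert z F"] z FH H by auto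
  have "rank M K \<le> rank M F + 1" unfolding K_def using rank_cl[OF zF] rank_insert_le by simp
  then have "K \<noteq> G" using rFH rGH by auto
  then have "K \<subset> G" using K by auto
  moreover have "c w = \<alpha> \<or> c w = \<beta>" if w: "w \<in> G" "w \<notin> K" for w
  proof (cases "w \<in> H")
    case True
    then show ?thesis using two_colours w K by auto
  next
    case False
    have "cl (insert z H) = G" using cl_insert_eq[OF H(1) G(1) H(3) z(1) zH] rGH by simp
    moreover have "w \<notin> cl {z}" using in_flat_point[OF K(1)] K w by auto
    ultimately obtain h where h: "h \<in> H" "w \<in> cl {h, z}" using line_through_apex[OF H(1) zg(1), of w] w by auto
    have "h \<notin> F" using in_flat_line[OF K(1) _ _ h(2)] K w by auto
    then show ?thesis using claim2[OF h(1) _ h(2)] \<open>w \<notin> cl {z}\<close> by auto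
  qed
  ultimately have "peelable G" by (rule peelableI[OF K(1)])
  then show False using not_peelable by simp
qed

text \<open>With at most two colours everything can be peeled off. Three elements of distinct
  colours are independent, as no line is rainbow, so otherwise the rank is at least 3.\<close>

lemma nonempty_flat_peelable: "flat M G \<Longrightarrow> G \<noteq> {} \<Longrightarrow> peelable G"
proof (induction "rank M G" arbitrary: G rule: less_induct)
  case less
  have Gg: "G \<subseteq> ground M" using less.prems flat_ground by auto
  show ?case
  proof (cases "card (c ` G) \<le> 2")
    case True
    then show ?thesis using less.prems flat_empty unfolding peelable_def by (intro exI[of _ "{}"]) auto
  next
    case False
    then obtain T where "T \<subseteq> c ` G" "card T = 3" using obtain_subset_with_card_n[of 3 "c ` G"] by auto
    then obtain x1 x2 x3 where x: "x1 \<in> G" "x2 \<in> G" "x3 \<in> G" "c x1 \<noteq> c x2" "c x1 \<noteq> c x3" "c x2 \<noteq> c x3"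
      by (auto simp: card_3_iff)
    have xg: "x1 \<in> ground M" "x2 \<in> ground M" "x3 \<in> ground M" using x Gg by auto
    have "x2 \<notin> cl {x1}" using cl_singleton_colour[of x1 x2] xg x by auto
    then have "rank M {x1, x2} = 2" using rank_pair xg by auto
    moreover have "x3 \<notin> cl {x1, x2}" using no_rainbow_line[of x1 x2 x3] xg x by auto
    then have "rank M (insert x3 {x1, x2}) \<noteq> rank M {x1, x2}" using xg by (simp add: in_cl_iff)
    ultimately have "3 \<le> rank M (insert x3 {x1, x2})" using rank_le_insert[of "{x1, x2}" x3] by linarith
    also have "\<dots> \<le> rank M G" by (rule rank_mono) (use x in auto)
    finally have "rank M G = 3 \<or> 4 \<le> rank M G" by linarith
    then show ?thesis
    proof
      assume "rank M G = 3"
      then show ?thesis using peelable_plane[OF less.prems(1), of "c x1" "c x2" "c x3"] x by auto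
    next
      assume "4 \<le> rank M G"
      then show ?thesis using peelable_step[OF less.prems(1) _ x] less.hyps by blast
    qed
  qed
qed

text \<open>Peeling \<open>G\<close> down to the empty flat, each layer adds its rank to the weight of a pair of
  colours containing all colours of the layer.\<close>

lemma colour_pair_weights:
  assumes C: "finite C" "2 \<le> card C"
  shows "flat M G \<Longrightarrow> c ` G \<subseteq> C \<Longrightarrow>
    \<exists>w :: 'c set \<Rightarrow> nat. (\<Sum>Q | Q \<subseteq> C \<and> card Q = 2. w Q) = rank M G \<and>
      (\<forall>S\<subseteq>C. \<exists>F. flat M F \<and> F \<subseteq> G \<and> c ` F \<subseteq> S \<and> (\<Sum>Q | Q \<subseteq> S \<and> card Q = 2. w Q) \<le> rank M F)"
proof (induction "rank M G" arbitrary: G rule: less_induct)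
  case less
  show ?case
  proof (cases "G = {}")
    case True
    then show ?thesis using flat_empty by (intro exI[of _ "\<lambda>_. 0"]) auto
  next
    case False
    then have "peelable G" using nonempty_flat_peelable less.prems by simp
    then obtain F where F: "flat M F" "F \<subset> G" "card (c ` (G - F)) \<le> 2"
      by (auto simp: peelable_def)
    have FG: "F \<subseteq> G" using F by auto
    have "c ` (G - F) \<subseteq> C" using less.prems by auto
    \<comment> \<open>The layer may use fewer than two colours; it is padded to a pair
      \<open>R\<close>, which is possible because \<open>C\<close> has at least two
      elements.\<close>
    then obtain R where R: "c ` (G - F) \<subseteq> R" "R \<subseteq> C" "card R = 2"
      using exists_subset_between[OF F(3) C(2) _ C(1)] by auto
    have rFG: "rank M F < rank M G" by (rule flat_psubset_rank[OF F(1) less.prems(1) F(2)])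
    have "c ` F \<subseteq> C" using less.prems FG by auto
    then obtain w where w: "(\<Sum>Q | Q \<subseteq> C \<and> card Q = 2. w Q) = rank M F"
      "\<And>S. S \<subseteq> C \<Longrightarrow> \<exists>F'. flat M F' \<and> F' \<subseteq> F \<and> c ` F' \<subseteq> S \<and> (\<Sum>Q | Q \<subseteq> S \<and> card Q = 2. w Q) \<le> rank M F'"
      using less.hyps[OF rFG F(1)] by blast
    obtain D where D: "flat M D" "D \<subseteq> G" "F \<inter> D = {}" "cl (F \<union> D) = G" "rank M F + rank M D = rank M G"
      using flat_complement[OF F(1) less.prems(1) FG] .
    define w' where "w' Q = w Q + (if Q = R then rank M D else 0)" for Q
    have w': "(\<Sum>Q | Q \<subseteq> S \<and> card Q = 2. w' Q) =
        (\<Sum>Q | Q \<subseteq> S \<and> card Q = 2. w Q) + (if R \<subseteq> S then rank M D else 0)" if "S \<subseteq> C" for S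
    proof -
      have "finite S" using that C(1) by (rule finite_subset)
      then have "finite {Q. Q \<subseteq> S \<and> card Q = 2}" by auto
      then show ?thesis using R by (simp add: w'_def sum.distrib sum.delta)
    qed
    have "\<exists>F. flat M F \<and> F \<subseteq> G \<and> c ` F \<subseteq> S \<and> (\<Sum>Q | Q \<subseteq> S \<and> card Q = 2. w' Q) \<le> rank M F"
      if S: "S \<subseteq> C" for S
    proof -
      obtain E where E: "flat M E" "E \<subseteq> F" "c ` E \<subseteq> S" "(\<Sum>Q | Q \<subseteq> S \<and> card Q = 2. w Q) \<le> rank M E"
        using w(2)[OF S] by auto
      show ?thesis
      proof (cases "R \<subseteq> S")
        case False
        then show ?thesis using E FG w'[OF S] by auto
      next
        case True
        have ED: "E \<union> D \<subseteq> G" using E D FG by auto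
        then have EDg: "E \<union> D \<subseteq> ground M" using less.prems flat_ground by blast
        \<comment> \<open>The complement \<open>D\<close> of the new layer is joined to the flat
          \<open>E\<close> found inside \<open>F\<close>; as they are disjoint, their ranks
          add.\<close>
        define K where "K = cl (E \<union> D)"
        have K: "flat M K" "E \<union> D \<subseteq> K" "K \<subseteq> G"
          unfolding K_def using EDg subset_cl[OF EDg] cl_least[OF less.prems(1) ED] by auto
        have "E \<inter> D = {}" using E D by auto
        then have rK: "rank M K = rank M E + rank M D"
          using rank_modular[OF E(1) D(1)] by (simp add: K_def)
        have "cl (F \<union> K) = G"
        proof
          show "cl (F \<union> K) \<subseteq> G" by (rule cl_least) (use less.prems FG K in auto)
          show "G \<subseteq> cl (F \<union> K)" using D(4) cl_mono[of "F \<union> D" "F \<union> K"] K by auto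
        qed
        \<comment> \<open>A second use of modularity shows that the join acquires no new element of
          \<open>F\<close>. So \<open>K\<close> consists of \<open>E\<close> and elements of the
          layer, whose colours lie in \<open>R\<close>.\<close>
        then have "rank M (F \<inter> K) = rank M E" using rank_modular[OF F(1) K(1)] D rK by simp
        then have FK: "E = F \<inter> K" using E K F by (intro flat_subset_rank_eq flat_Int) auto
        have "c ` K \<subseteq> S"
        proof (rule image_subsetI)
          fix x assume "x \<in> K"
          then have "x \<notin> F \<Longrightarrow> c x \<in> R" "x \<in> F \<Longrightarrow> x \<in> E" using FK R(1) K(3)
            by (auto simp: image_subset_iff)
          then show "c x \<in> S" using E(3) True by (auto simp: image_subset_iff)
        qed
        then show ?thesis using K w'[OF S] True E rK by auto
      qed
    qed
    moreover have "(\<Sum>Q | Q \<subseteq> C \<and> card Q = 2. w' Q) = rank M G" using w'[OF subset_refl] w R D by simp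
    ultimately show ?thesis by blast
  qed
qed

end

section \<open>Averaging over colour sets\<close>

lemma card_subsets_containing:
  assumes "finite C" "Q \<subseteq> C"
  shows "card {S. Q \<subseteq> S \<and> S \<subseteq> C \<and> card S = card Q + m} = (card C - card Q) choose m"
proof -
  have fin: "finite Q" using assms finite_subset by blast
  have "bij_betw (\<lambda>T. T \<union> Q) {T. T \<subseteq> C - Q \<and> card T = m}
      {S. Q \<subseteq> S \<and> S \<subseteq> C \<and> card S = card Q + m}"
  proof (rule bij_betw_byWitness[where f' = "\<lambda>S. S - Q"])
    have "T \<union> Q \<in> {S. Q \<subseteq> S \<and> S \<subseteq> C \<and> card S = card Q + m}" if T: "T \<subseteq> C - Q" "card T = m" for T
    proof -
      have "finite T" using assms T finite_subset[of T C] by auto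
      then have "card (T \<union> Q) = card T + card Q" using T fin by (intro card_Un_disjoint) auto
      then show ?thesis using T assms by auto
    qed
    then show "(\<lambda>T. T \<union> Q) ` {T. T \<subseteq> C - Q \<and> card T = m}
        \<subseteq> {S. Q \<subseteq> S \<and> S \<subseteq> C \<and> card S = card Q + m}" by blast
    show "(\<lambda>S. S - Q) ` {S. Q \<subseteq> S \<and> S \<subseteq> C \<and> card S = card Q + m}
        \<subseteq> {T. T \<subseteq> C - Q \<and> card T = m}"
      using fin by (auto simp: card_Diff_subset)
  qed auto
  then have "card {S. Q \<subseteq> S \<and> S \<subseteq> C \<and> card S = card Q + m} = card {T. T \<subseteq> C - Q \<and> card T = m}"
    by (simp add: bij_betw_same_card)
  also have "\<dots> = card (C - Q) choose m" using assms by (intro n_subsets) auto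
  finally show ?thesis using assms fin by (simp add: card_Diff_subset)
qed

text \<open>Averaging over all subsets of size \<open>l\<close>. The inequality is cross-multiplied
  so that it stays in the natural numbers.\<close>

lemma heavy_subset_exists:
  fixes w :: "'c set \<Rightarrow> nat"
  assumes C: "finite C" and l: "2 \<le> l" "l \<le> card C"
  obtains S where "S \<subseteq> C" "card S = l"
    "(l choose 2) * (\<Sum>Q | Q \<subseteq> C \<and> card Q = 2. w Q)
      \<le> (card C choose 2) * (\<Sum>Q | Q \<subseteq> S \<and> card Q = 2. w Q)"
proof -
  define k where "k = card C"
  define subs where "subs = {S. S \<subseteq> C \<and> card S = l}"
  define pairs where "pairs = {Q. Q \<subseteq> C \<and> card Q = 2}"
  define tot where "tot = sum w pairs"
  define W where "W S = (\<Sum>Q | Q \<subseteq> S \<and> card Q = 2. w Q)" for S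
  have fin: "finite subs" "finite pairs" using C by (auto simp: subs_def pairs_def)
  have card_subs: "card subs = k choose l" unfolding subs_def k_def by (rule n_subsets[OF C])
  have "(\<Sum>S\<in>subs. W S) = (\<Sum>S\<in>subs. \<Sum>Q\<in>pairs. if Q \<subseteq> S then w Q else 0)"
  proof (rule sum.cong[OF refl])
    fix S assume "S \<in> subs"
    then have "{Q. Q \<subseteq> S \<and> card Q = 2} = {Q \<in> pairs. Q \<subseteq> S}" by (auto simp: subs_def pairs_def)
    then show "W S = (\<Sum>Q\<in>pairs. if Q \<subseteq> S then w Q else 0)"
      unfolding W_def by (simp add: sum.inter_filter[OF fin(2)])
  qed
  \<comment> \<open>Double counting: after the exchange of sums, each pair is weighted by the number
    of sets of size \<open>l\<close> containing it.\<close>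
  also have "\<dots> = (\<Sum>Q\<in>pairs. \<Sum>S\<in>subs. if Q \<subseteq> S then w Q else 0)" by (rule sum.swap)
  also have "\<dots> = (\<Sum>Q\<in>pairs. w Q * ((k - 2) choose (l - 2)))"
  proof (rule sum.cong[OF refl])
    fix Q assume Q: "Q \<in> pairs"
    have "{S \<in> subs. Q \<subseteq> S} = {S. Q \<subseteq> S \<and> S \<subseteq> C \<and> card S = card Q + (l - 2)}"
      using Q l by (auto simp: subs_def pairs_def)
    then have "card {S \<in> subs. Q \<subseteq> S} = (k - 2) choose (l - 2)"
      using card_subsets_containing[OF C, of Q "l - 2"] Q by (simp add: pairs_def k_def)
    moreover have "(\<Sum>S\<in>subs. if Q \<subseteq> S then w Q else 0) = card {S \<in> subs. Q \<subseteq> S} * w Q"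
      by (simp add: sum.inter_filter[OF fin(1), symmetric])
    ultimately show "(\<Sum>S\<in>subs. if Q \<subseteq> S then w Q else 0) = w Q * ((k - 2) choose (l - 2))"
      by simp
  qed
  also have "\<dots> = tot * ((k - 2) choose (l - 2))" by (simp add: tot_def sum_distrib_right)
  finally have sumW: "(\<Sum>S\<in>subs. W S) = tot * ((k - 2) choose (l - 2))" .
  \<comment> \<open>Both sides count a set of size \<open>l\<close> with a marked pair in it; the
    identity turns the total into an exact average.\<close>
  have "(k choose l) * (l choose 2) = (k choose 2) * ((k - 2) choose (l - 2))"
    using l by (intro choose_mult) (auto simp: k_def)
  then have avg: "(\<Sum>S\<in>subs. (k choose 2) * W S) = (\<Sum>S\<in>subs. (l choose 2) * tot)"
    using sumW card_subs by (simp add: sum_distrib_left[symmetric])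
  have "subs \<noteq> {}" using card_subs l by (metis card.empty binomial_eq_0_iff k_def leD)
  have "\<exists>S\<in>subs. (l choose 2) * tot \<le> (k choose 2) * W S"
  proof (rule ccontr)
    assume "\<not> ?thesis"
    then have "(\<Sum>S\<in>subs. (k choose 2) * W S) < (\<Sum>S\<in>subs. (l choose 2) * tot)"
      using \<open>subs \<noteq> {}\<close> fin by (intro sum_strict_mono) auto
    then show False using avg by simp
  qed
  then show ?thesis using that by (auto simp: subs_def W_def tot_def pairs_def k_def)
qed

theorem theorem8p3:
  fixes M :: "'a matroid_data" and c :: "'a \<Rightarrow> 'c" and l k :: nat
  assumes "l \<le> k" and "2 \<le> k"
    and "matroid M"
    and "connected_matroid M"
    and "modular_matroid M"
    and "simple_colouring M c"
    and "\<not> (\<exists>T. rainbow_triangle M c T)"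
    and "num_colours M c = k"
  shows "\<exists>F. flat M F \<and> card (c ` F) \<le> l \<and>
           real (rank M F) \<ge> real (l choose 2) / real (k choose 2) * real (rank M (ground M))"
proof -
  interpret rainbow_free_geometry M c
    using assms by (simp add: rainbow_free_geometry_def rainbow_free_geometry_axioms_def)
  show ?thesis
  proof (cases "2 \<le> l")
    \<comment> \<open>For \<open>l < 2\<close> the coefficient \<open>l choose 2\<close> is 0, so
      the empty flat suffices.\<close>
    case False
    then show ?thesis using flat_empty by (intro exI[of _ "{}"]) (simp add: binomial_eq_0)
  next
    case True
    define C where "C = c ` ground M"
    have C: "finite C" "card C = k" using ground_finite assms(8) by (auto simp: C_def num_colours_def)
    obtain w :: "'c set \<Rightarrow> nat" where w: "(\<Sum>Q | Q \<subseteq> C \<and> card Q = 2. w Q) = rank M (ground M)"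
      "\<And>S. S \<subseteq> C \<Longrightarrow> \<exists>F. flat M F \<and> F \<subseteq> ground M \<and> c ` F \<subseteq> S \<and>
        (\<Sum>Q | Q \<subseteq> S \<and> card Q = 2. w Q) \<le> rank M F"
      using colour_pair_weights[OF C(1) _ flat_ground_set] C assms(2) by (auto simp: C_def)
    obtain S where S: "S \<subseteq> C" "card S = l"
      "(l choose 2) * (\<Sum>Q | Q \<subseteq> C \<and> card Q = 2. w Q)
        \<le> (card C choose 2) * (\<Sum>Q | Q \<subseteq> S \<and> card Q = 2. w Q)"
      \<comment> \<open>The total weight is the rank of \<open>M\<close>, and the weight of pairs
        inside \<open>S\<close> is a lower bound for the rank of a flat coloured from
        \<open>S\<close>.\<close>
      using heavy_subset_exists[OF C(1) True, of w] C assms(1) by auto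
    obtain F where F: "flat M F" "c ` F \<subseteq> S" "(\<Sum>Q | Q \<subseteq> S \<and> card Q = 2. w Q) \<le> rank M F"
      using w(2)[OF S(1)] by auto
    have "finite S" using S(1) C(1) by (rule finite_subset)
    then have "card (c ` F) \<le> l" using card_mono[OF _ F(2)] S by simp
    moreover have "(l choose 2) * rank M (ground M) \<le> (k choose 2) * rank M F"
      using S(3) mult_le_mono2[OF F(3), of "k choose 2"] unfolding w(1) C(2) by (rule le_trans)
    then have "real (l choose 2) * real (rank M (ground M)) \<le> real (k choose 2) * real (rank M F)"
      by (metis of_nat_le_iff of_nat_mult)
    moreover have "0 < k choose 2" using assms(2) by (simp add: zero_less_binomial)
    ultimately show ?thesis using F(1)
      by (intro exI[of _ F]) (simp add: divide_le_eq mult.commute)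
  qed
qed

end
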